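(* Let $(a_n)_{n\in\mathbb N}$ be complex numbers such that the Nörlund matrix $N_{|{\bf a}|}$ associated with $(|a_n|)_{n\in\mathbb N}$ is bounded on $\ell^2(\mathbb N)$, and let $A_n=\sum_{k=0}^n|a_k|$. Let $P$ be a contraction on $L^2(m)$ for a ($\sigma$-finite) measure space $(Y,m)$, and let $f\in L^2(m)$ satisfy $$\sum_{n\ge1}(\log(n+1))^2A_{2^{n+1}}^2\|P^{2^n}f\|_{L^2(m)}^2<\infty .$$ Then the series $\sum_{n\in\mathbb N}a_nP^nf$ converges $m$-almost everywhere and $\sup_{N\ge1}\big|\sum_{n=0}^Na_nP^nf\big|\in L^2(m)$.
   Context: For a sequence ${\bf b}=(b_n)$ of complex numbers with $B_i=\sum_{k=0}^i|b_k|$, the Nörlund matrix $N_{\bf b}$ has entries $b_{i-j}/B_i$ for $0\le j\le i$ with $B_i>0$ and $0$ otherwise; it is bounded on $\ell^2(\mathbb N)$ if $\|N_{\bf b}u\|_{\ell^2}\le C\|u\|_{\ell^2}$ for all finitely supported $u$. $P$ is a (not necessarily positive) linear operator of norm at most $1$ on $L^2(m)$. *)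

theory Defs
  imports "HOL-Analysis.Analysis"
begin

definition norlund_B :: "(nat \<Rightarrow> complex) \<Rightarrow> nat \<Rightarrow> real" where
  "norlund_B b i = (\<Sum>k\<le>i. cmod (b k))"

definition norlund_entry :: "(nat \<Rightarrow> complex) \<Rightarrow> nat \<Rightarrow> nat \<Rightarrow> complex" where
  "norlund_entry b i j =
     (if j \<le> i \<and> norlund_B b i > 0 then b (i - j) / complex_of_real (norlund_B b i) else 0)"

definition norlund_apply :: "(nat \<Rightarrow> complex) \<Rightarrow> (nat \<Rightarrow> complex) \<Rightarrow> nat \<Rightarrow> complex" where
  "norlund_apply b u i = (\<Sum>j\<le>i. norlund_entry b i j * u j)"

text \<open>Boundedness on l^2: ||N_b u||_2 <= C ||u||_2 for all finitely supported u
  (the l^2 norm of N_b u expressed via its partial sums).\<close>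
definition norlund_bounded :: "(nat \<Rightarrow> complex) \<Rightarrow> bool" where
  "norlund_bounded b \<longleftrightarrow> (\<exists>C::real. \<forall>u::nat \<Rightarrow> complex. finite {j. u j \<noteq> 0} \<longrightarrow>
      (\<forall>n. (\<Sum>i<n. (cmod (norlund_apply b u i))\<^sup>2)
              \<le> C\<^sup>2 * (\<Sum>j\<in>{j. u j \<noteq> 0}. (cmod (u j))\<^sup>2)))"

definition L2_mem :: "'a measure \<Rightarrow> ('a \<Rightarrow> complex) \<Rightarrow> bool" where
  "L2_mem M f \<longleftrightarrow> f \<in> borel_measurable M \<and> integrable M (\<lambda>x. (cmod (f x))\<^sup>2)"

definition L2_norm :: "'a measure \<Rightarrow> ('a \<Rightarrow> complex) \<Rightarrow> real" where
  "L2_norm M f = sqrt (\<integral>x. (cmod (f x))\<^sup>2 \<partial>M)"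

text \<open>A (not necessarily positive) linear operator of norm at most 1 on L^2(M),
  acting on representatives: it maps L^2 to L^2, respects equality a.e.,
  is linear modulo a.e. equality, and is norm-nonincreasing.\<close>
definition L2_contraction :: "'a measure \<Rightarrow> (('a \<Rightarrow> complex) \<Rightarrow> ('a \<Rightarrow> complex)) \<Rightarrow> bool" where
  "L2_contraction M P \<longleftrightarrow>
     (\<forall>f. L2_mem M f \<longrightarrow> L2_mem M (P f)) \<and>
     (\<forall>f g. L2_mem M f \<longrightarrow> L2_mem M g \<longrightarrow> (AE x in M. f x = g x) \<longrightarrow> (AE x in M. P f x = P g x)) \<and>
     (\<forall>f g c. L2_mem M f \<longrightarrow> L2_mem M g \<longrightarrow>
        (AE x in M. P (\<lambda>y. f y + c * g y) x = P f x + c * P g x)) \<and>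
     (\<forall>f. L2_mem M f \<longrightarrow> L2_norm M (P f) \<le> L2_norm M f)"

end

theory Submission
  imports Defs
begin

text \<open>
  Put \<open>A\<^sub>i = \<Sum>j\<le>i. |a\<^sub>j|\<close> and \<open>Q h = \<parallel>h\<parallel>\<^sup>2 - \<parallel>P h\<parallel>\<^sup>2\<close>. Since \<open>Q\<close> is a nonnegative quadratic form,
  its square root is a seminorm, and \<open>\<parallel>h\<parallel>\<^sup>2 = (\<Sum>k<q. Q (P^k h)) + \<parallel>P^q h\<parallel>\<^sup>2\<close> by telescoping. For
  \<open>h = \<Sum>p<n\<le>q. a\<^sub>n P^n f\<close> the seminorm of \<open>P^k h\<close> is at most \<open>\<Sum>n. |a\<^sub>n| sqrt (Q (P^(n+k) f))\<close>,
  which is the transposed Norlund matrix applied to \<open>A\<^sub>i sqrt (Q (P^i f))\<close>. Hence the dyadic blocks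
  \<open>D\<^sub>k = \<Sum>2^k<n\<le>2^(k+1). a\<^sub>n P^n f\<close> satisfy
  \<open>\<parallel>\<Sum>s\<le>k<t. D\<^sub>k\<parallel>\<^sup>2 \<le> K (\<Sum>s\<le>k<t. c\<^sub>k)\<close> with \<open>c\<^sub>k = A\<^sub>i\<^sup>2 \<parallel>P^(2^k) f\<parallel>\<^sup>2\<close>, \<open>i = 2^(k+1)\<close>, as if they
  were orthogonal, so the Rademacher--Menshov argument applies to \<open>\<Sum>k. D\<^sub>k\<close>. Inside a
  single block the triangle inequality suffices: \<open>\<Sum>2^k<n\<le>2^(k+1). |a\<^sub>n| |P^n f|\<close> has squared norm
  at most \<open>c\<^sub>k\<close>.
\<close>

section \<open>The defect of a contraction\<close>

lemma L2_norm_nonneg: "L2_norm M f \<ge> 0"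
  by (simp add: L2_norm_def)

lemma L2_norm_power2: "(L2_norm M f)\<^sup>2 = (\<integral>x. (cmod (f x))\<^sup>2 \<partial>M)"
  by (simp add: L2_norm_def integral_nonneg_AE)

lemma L2_norm_cong_AE:
  assumes "L2_mem M f" "L2_mem M g" "AE x in M. f x = g x"
  shows "L2_norm M f = L2_norm M g"
proof -
  have "(\<integral>x. (cmod (f x))\<^sup>2 \<partial>M) = (\<integral>x. (cmod (g x))\<^sup>2 \<partial>M)"
    using assms by (intro integral_cong_AE) (auto simp: L2_mem_def)
  then show ?thesis
    by (simp add: L2_norm_def)
qed

lemma L2_mem_zero: "L2_mem M (\<lambda>_. 0)"
  by (simp add: L2_mem_def)

lemma L2_mem_add_scaled:
  assumes "L2_mem M f" "L2_mem M g"
  shows "L2_mem M (\<lambda>x. f x + c * g x)"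
proof -
  have [measurable]: "f \<in> borel_measurable M" "g \<in> borel_measurable M"
    using assms by (auto simp: L2_mem_def)
  have bound: "(cmod (u + c * v))\<^sup>2 \<le> 2 * (cmod u)\<^sup>2 + 2 * (cmod c)\<^sup>2 * (cmod v)\<^sup>2" for u v
  proof -
    have "(cmod (u + c * v))\<^sup>2 \<le> (cmod u + cmod c * cmod v)\<^sup>2"
      by (intro power_mono norm_triangle_le) (auto simp: norm_mult)
    also have "\<dots> \<le> 2 * (cmod u)\<^sup>2 + 2 * (cmod c * cmod v)\<^sup>2"
      using sum_squares_bound[of "cmod u" "cmod c * cmod v"] by (simp add: power2_sum)
    finally show ?thesis by (simp add: power_mult_distrib)
  qed
  have "integrable M (\<lambda>x. 2 * (cmod (f x))\<^sup>2 + 2 * (cmod c)\<^sup>2 * (cmod (g x))\<^sup>2)"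
    using assms by (auto simp: L2_mem_def)
  then have "integrable M (\<lambda>x. (cmod (f x + c * g x))\<^sup>2)"
    by (rule Bochner_Integration.integrable_bound) (use bound in auto)
  then show ?thesis by (simp add: L2_mem_def)
qed

lemma L2_mem_sum:
  assumes "finite F" "\<And>n. n \<in> F \<Longrightarrow> L2_mem M (g n)"
  shows "L2_mem M (\<lambda>x. \<Sum>n\<in>F. a n * g n x)"
  using assms
proof (induction F rule: finite_induct)
  case empty
  show ?case by (simp add: L2_mem_zero)
next
  case (insert m F)
  then have "L2_mem M (\<lambda>x. (\<Sum>n\<in>F. a n * g n x) + a m * g m x)"
    by (intro L2_mem_add_scaled) auto
  then show ?case using insert by (simp add: add.commute)
qed

lemma L2_mem_scaled:
  assumes "L2_mem M g"
  shows "L2_mem M (\<lambda>x. c * g x)"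
  using L2_mem_add_scaled[OF L2_mem_zero assms] by simp

text \<open>Here \<open>\<bullet>\<close> is the real inner product of the plane, Re (u cnj v). For
  real \<open>t\<close> the squared norm is therefore a real quadratic polynomial in
  \<open>t\<close>, which is what the discriminant argument for the defect needs.\<close>

lemma L2_norm_power2_add_real_scaled:
  assumes "L2_mem M f" "L2_mem M h"
  shows "(L2_norm M (\<lambda>x. f x + complex_of_real t * h x))\<^sup>2
    = (L2_norm M f)\<^sup>2 + 2 * t * (\<integral>x. f x \<bullet> h x \<partial>M) + t\<^sup>2 * (L2_norm M h)\<^sup>2"
proof -
  have [measurable]: "f \<in> borel_measurable M" "h \<in> borel_measurable M"
    and sq: "integrable M (\<lambda>x. (cmod (f x))\<^sup>2)" "integrable M (\<lambda>x. (cmod (h x))\<^sup>2)"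
    using assms by (auto simp: L2_mem_def)
  have bound: "\<bar>u \<bullet> v\<bar> \<le> (cmod u)\<^sup>2 + (cmod v)\<^sup>2" for u v :: complex
  proof -
    have "\<bar>u \<bullet> v\<bar> \<le> cmod u * cmod v"
      by (rule Cauchy_Schwarz_ineq2)
    also have "\<dots> \<le> (cmod u)\<^sup>2 + (cmod v)\<^sup>2"
      using sum_squares_bound[of "cmod u" "cmod v"] zero_le_power2[of "cmod u"]
        zero_le_power2[of "cmod v"] mult_nonneg_nonneg[of "cmod u" "cmod v"] norm_ge_zero
      by linarith
    finally show ?thesis .
  qed
  have int: "integrable M (\<lambda>x. f x \<bullet> h x)"
    by (rule Bochner_Integration.integrable_bound[OF Bochner_Integration.integrable_add[OF sq]])
       (use bound in auto)
  have expand: "(cmod (u + complex_of_real t * v))\<^sup>2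
      = (cmod u)\<^sup>2 + 2 * t * (u \<bullet> v) + t\<^sup>2 * (cmod v)\<^sup>2" for u v
    unfolding cmod_power2 by (simp add: inner_complex_def power2_eq_square algebra_simps)
  show ?thesis
    unfolding L2_norm_power2 expand using sq int by simp
qed

text \<open>The quadratic form of I - P* P, written with norms alone so that no adjoint has to be
  constructed on representatives.\<close>

definition defect :: "'a measure \<Rightarrow> (('a \<Rightarrow> complex) \<Rightarrow> 'a \<Rightarrow> complex) \<Rightarrow> ('a \<Rightarrow> complex) \<Rightarrow> real" where
  "defect M P h = (L2_norm M h)\<^sup>2 - (L2_norm M (P h))\<^sup>2"

lemma L2_contraction_mem: "L2_contraction M P \<Longrightarrow> L2_mem M f \<Longrightarrow> L2_mem M (P f)"
  by (simp add: L2_contraction_def)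

lemma L2_contraction_cong:
  "L2_contraction M P \<Longrightarrow> L2_mem M f \<Longrightarrow> L2_mem M g \<Longrightarrow> AE x in M. f x = g x
    \<Longrightarrow> AE x in M. P f x = P g x"
  unfolding L2_contraction_def by blast

lemma L2_contraction_linear:
  "L2_contraction M P \<Longrightarrow> L2_mem M f \<Longrightarrow> L2_mem M g
    \<Longrightarrow> AE x in M. P (\<lambda>y. f y + c * g y) x = P f x + c * P g x"
  unfolding L2_contraction_def by blast

lemma L2_contraction_norm_le:
  "L2_contraction M P \<Longrightarrow> L2_mem M f \<Longrightarrow> L2_norm M (P f) \<le> L2_norm M f"
  by (simp add: L2_contraction_def)

lemma L2_contraction_zero:
  assumes "L2_contraction M P"
  shows "AE x in M. P (\<lambda>_. 0) x = 0"
  \<comment> \<open>Since 0 + (-1) 0 is again the zero function, linearity reads P 0 = P 0 - P 0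
    almost everywhere.\<close>
  using L2_contraction_linear[OF assms L2_mem_zero L2_mem_zero, of "-1"] by simp

lemma L2_contraction_funpow_mem:
  "L2_contraction M P \<Longrightarrow> L2_mem M f \<Longrightarrow> L2_mem M ((P ^^ n) f)"
  by (induction n) (auto simp: L2_contraction_mem)

lemma L2_contraction_funpow_antimono:
  assumes "L2_contraction M P" "L2_mem M f" "m \<le> n"
  shows "L2_norm M ((P ^^ n) f) \<le> L2_norm M ((P ^^ m) f)"
  using assms(3)
proof (induction n rule: dec_induct)
  case (step n)
  then show ?case
    using L2_contraction_norm_le[OF assms(1) L2_contraction_funpow_mem[OF assms(1,2)], of n]
    by simp
qed simp

lemma L2_contraction_sum:
  assumes "L2_contraction M P" "finite F" "\<And>n. n \<in> F \<Longrightarrow> L2_mem M (g n)"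
  shows "AE x in M. P (\<lambda>y. \<Sum>n\<in>F. a n * g n y) x = (\<Sum>n\<in>F. a n * P (g n) x)"
  using assms(2,3)
proof (induction F rule: finite_induct)
  case empty
  show ?case using L2_contraction_zero[OF assms(1)] by simp
next
  case (insert m F)
  have "AE x in M. P (\<lambda>y. (\<Sum>n\<in>F. a n * g n y) + a m * g m y) x
      = P (\<lambda>y. \<Sum>n\<in>F. a n * g n y) x + a m * P (g m) x"
    using insert by (intro L2_contraction_linear[OF assms(1)] L2_mem_sum) auto
  moreover have "AE x in M. P (\<lambda>y. \<Sum>n\<in>F. a n * g n y) x = (\<Sum>n\<in>F. a n * P (g n) x)"
    using insert by auto
  ultimately show ?case
    using insert(1,2) by (auto simp: add.commute)
qed

text \<open>Linearity holds only up to null sets, so the identity for \<open>k\<close> cannot be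
  rewritten under \<open>P\<close>; it is carried through by the compatibility of \<open>P\<close>
  with equality almost everywhere.\<close>

lemma L2_contraction_funpow_sum:
  assumes P: "L2_contraction M P" and "finite F" and g: "\<And>n. n \<in> F \<Longrightarrow> L2_mem M (g n)"
  shows "AE x in M. (P ^^ k) (\<lambda>y. \<Sum>n\<in>F. a n * g n y) x = (\<Sum>n\<in>F. a n * (P ^^ k) (g n) x)"
proof (induction k)
  case (Suc k)
  have "AE x in M. P ((P ^^ k) (\<lambda>y. \<Sum>n\<in>F. a n * g n y)) x
      = P (\<lambda>y. \<Sum>n\<in>F. a n * (P ^^ k) (g n) y) x"
  proof (rule L2_contraction_cong[OF P _ _ Suc])
    show "L2_mem M ((P ^^ k) (\<lambda>y. \<Sum>n\<in>F. a n * g n y))"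
      using assms by (intro L2_contraction_funpow_mem[OF P] L2_mem_sum)
    show "L2_mem M (\<lambda>y. \<Sum>n\<in>F. a n * (P ^^ k) (g n) y)"
      using assms by (intro L2_mem_sum L2_contraction_funpow_mem[OF P])
  qed
  moreover have "AE x in M. P (\<lambda>y. \<Sum>n\<in>F. a n * (P ^^ k) (g n) y) x
      = (\<Sum>n\<in>F. a n * P ((P ^^ k) (g n)) x)"
    using assms by (intro L2_contraction_sum[OF P] L2_contraction_funpow_mem[OF P]) auto
  ultimately show ?case by auto
qed simp

lemma defect_nonneg: "L2_contraction M P \<Longrightarrow> L2_mem M h \<Longrightarrow> defect M P h \<ge> 0"
  by (simp add: defect_def L2_contraction_norm_le L2_norm_nonneg power_mono)

lemma defect_zero:
  assumes "L2_contraction M P"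
  shows "defect M P (\<lambda>_. 0) = 0"
proof -
  have "L2_norm M (P (\<lambda>_. 0)) = L2_norm M (\<lambda>_. 0)"
    by (intro L2_norm_cong_AE[OF _ _ L2_contraction_zero[OF assms]] L2_contraction_mem[OF assms]
        L2_mem_zero)
  then show ?thesis by (simp add: defect_def)
qed

lemma defect_cong_AE:
  assumes "L2_contraction M P" "L2_mem M f" "L2_mem M g" "AE x in M. f x = g x"
  shows "defect M P f = defect M P g"
  unfolding defect_def
  using L2_norm_cong_AE[OF assms(2-4)]
    L2_norm_cong_AE[OF L2_contraction_mem[OF assms(1,2)] L2_contraction_mem[OF assms(1,3)]
      L2_contraction_cong[OF assms]]
  by simp

text \<open>A real quadratic polynomial without sign change has nonpositive discriminant. For
  \<open>Y = 0\<close> it is affine, and a positive slope would make it negative somewhere.\<close>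

lemma quadratic_nonneg_imp_le:
  fixes X Y b :: real
  assumes "X \<ge> 0" "Y \<ge> 0" and pos: "\<And>t. X + 2 * t * b + t\<^sup>2 * Y \<ge> 0"
  shows "b \<le> sqrt X * sqrt Y"
proof (cases "Y = 0")
  case True
  show ?thesis
  proof (rule ccontr)
    assume "\<not> ?thesis"
    then have "b > 0" using True by simp
    \<comment> \<open>This \<open>t\<close> is the point where the affine function takes the value
      -1.\<close>
    then have "X + 2 * (- (X + 1) / (2 * b)) * b + (- (X + 1) / (2 * b))\<^sup>2 * Y = - 1"
      using True by (simp add: field_simps)
    then show False
      using pos[of "- (X + 1) / (2 * b)"] by simp
  qed
next
  case False
  then have "Y > 0" using assms by simp
  \<comment> \<open>The test point -b/Y is the minimiser of the quadratic.\<close>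
  then have "b\<^sup>2 \<le> X * Y"
    using pos[of "- b / Y"] by (simp add: field_simps power2_eq_square)
  then have "\<bar>b\<bar> \<le> sqrt (X * Y)"
    using real_le_rsqrt[of "\<bar>b\<bar>" "X * Y"] by simp
  then show ?thesis by (simp add: real_sqrt_mult)
qed

text \<open>Minkowski's inequality for a positive semidefinite form. Cauchy-Schwarz comes from
  nonnegativity of the defect along the line f + t (c g); absorbing the complex scalar
  \<open>c\<close> into the direction makes real \<open>t\<close> sufficient.\<close>

lemma defect_triangle:
  assumes P: "L2_contraction M P" and f: "L2_mem M f" and g: "L2_mem M g"
  shows "sqrt (defect M P (\<lambda>x. f x + c * g x)) \<le> sqrt (defect M P f) + cmod c * sqrt (defect M P g)"
proof -
  define X where "X = defect M P f"
  define Y where "Y = (cmod c)\<^sup>2 * defect M P g"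
  define b where "b = (\<integral>x. f x \<bullet> (c * g x) \<partial>M) - (\<integral>x. P f x \<bullet> (c * P g x) \<partial>M)"
  have scaled: "(L2_norm M (\<lambda>x. c * h x))\<^sup>2 = (cmod c)\<^sup>2 * (L2_norm M h)\<^sup>2" for h
    unfolding L2_norm_power2 by (simp add: norm_mult power_mult_distrib)
  have expand: "defect M P (\<lambda>x. f x + complex_of_real t * (c * g x)) = X + 2 * t * b + t\<^sup>2 * Y" for t
  proof -
    \<comment> \<open>Linearity is applied to \<open>g\<close> with the scalar t c, so P (c g) never
      has to be evaluated.\<close>
    have "L2_norm M (P (\<lambda>x. f x + complex_of_real t * c * g x))
        = L2_norm M (\<lambda>x. P f x + complex_of_real t * c * P g x)"
      by (rule L2_norm_cong_AE[OF _ _ L2_contraction_linear[OF P f g]])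
         (intro L2_contraction_mem[OF P] L2_mem_add_scaled f g)+
    then have "defect M P (\<lambda>x. f x + complex_of_real t * (c * g x))
        = (L2_norm M (\<lambda>x. f x + complex_of_real t * (c * g x)))\<^sup>2
          - (L2_norm M (\<lambda>x. P f x + complex_of_real t * (c * P g x)))\<^sup>2"
      by (simp add: defect_def mult.assoc)
    also have "\<dots> = X + 2 * t * b + t\<^sup>2 * Y"
      by (subst (1 2) L2_norm_power2_add_real_scaled)
         (auto intro!: f g L2_mem_scaled L2_contraction_mem[OF P]
           simp: X_def Y_def b_def defect_def scaled algebra_simps)
    finally show ?thesis .
  qed
  have "X \<ge> 0" "Y \<ge> 0"
    using defect_nonneg[OF P] f g by (auto simp: X_def Y_def)
  moreover have "X + 2 * t * b + t\<^sup>2 * Y \<ge> 0" for t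
    unfolding expand[symmetric]
    by (intro defect_nonneg[OF P] L2_mem_add_scaled f L2_mem_scaled g)
  ultimately have "b \<le> sqrt X * sqrt Y"
    by (rule quadratic_nonneg_imp_le)
  then have "defect M P (\<lambda>x. f x + c * g x) \<le> (sqrt X + sqrt Y)\<^sup>2"
    using expand[of 1] \<open>X \<ge> 0\<close> \<open>Y \<ge> 0\<close> by (simp add: power2_sum)
  then have "sqrt (defect M P (\<lambda>x. f x + c * g x)) \<le> sqrt X + sqrt Y"
    using \<open>X \<ge> 0\<close> \<open>Y \<ge> 0\<close> by (intro real_le_lsqrt) auto
  then show ?thesis
    by (simp add: X_def Y_def real_sqrt_mult)
qed

lemma defect_sum:
  assumes P: "L2_contraction M P" and "finite F" "\<And>n. n \<in> F \<Longrightarrow> L2_mem M (g n)"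
  shows "sqrt (defect M P (\<lambda>x. \<Sum>n\<in>F. a n * g n x)) \<le> (\<Sum>n\<in>F. cmod (a n) * sqrt (defect M P (g n)))"
  using assms(2,3)
proof (induction F rule: finite_induct)
  case empty
  show ?case by (simp add: defect_zero[OF P])
next
  case (insert m F)
  have "sqrt (defect M P (\<lambda>x. (\<Sum>n\<in>F. a n * g n x) + a m * g m x))
      \<le> sqrt (defect M P (\<lambda>x. \<Sum>n\<in>F. a n * g n x)) + cmod (a m) * sqrt (defect M P (g m))"
    using insert by (intro defect_triangle[OF P] L2_mem_sum) auto
  also have "\<dots> \<le> (\<Sum>n\<in>F. cmod (a n) * sqrt (defect M P (g n))) + cmod (a m) * sqrt (defect M P (g m))"
    using insert by simp
  finally show ?case using insert(1,2) by (simp add: add.commute)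
qed

lemma L2_norm_sum:
  fixes M :: "'b measure"
  assumes "finite F" "\<And>n. n \<in> F \<Longrightarrow> L2_mem M (g n)"
  shows "L2_norm M (\<lambda>x. \<Sum>n\<in>F. a n * g n x) \<le> (\<Sum>n\<in>F. cmod (a n) * L2_norm M (g n))"
proof -
  \<comment> \<open>The norm is the defect of the zero operator.\<close>
  let ?P = "(\<lambda>_ _. 0) :: ('b \<Rightarrow> complex) \<Rightarrow> 'b \<Rightarrow> complex"
  have "L2_contraction M ?P"
    by (auto simp: L2_contraction_def L2_mem_zero L2_norm_def)
  moreover have "sqrt (defect M ?P h) = L2_norm M h" for h
    by (simp add: defect_def L2_norm_def)
  ultimately show ?thesis
    using defect_sum[of M ?P F g a] assms by simp
qed

lemma L2_norm_power2_eq_sum_defect: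
  "(L2_norm M h)\<^sup>2 = (\<Sum>k<q. defect M P ((P ^^ k) h)) + (L2_norm M ((P ^^ q) h))\<^sup>2"
  by (induction q) (auto simp: defect_def)

section \<open>The transposed Norlund matrix\<close>

text \<open>Duality by testing: for w = N^T (A y) one has <w, w> = <A y, N w>, so Cauchy-Schwarz and
  the bound for N give |w|^2 \<le> |C| |A y| |w|, and |w| is divided out. The weight A_i on the
  right cancels the denominator of the matrix entry.\<close>

lemma norlund_transpose_bound:
  assumes "norlund_bounded (\<lambda>n. complex_of_real (cmod (a n)))"
  shows "\<exists>C::real\<ge>0. \<forall>q (y :: nat \<Rightarrow> real). (\<Sum>k\<le>q. (\<Sum>i\<in>{k..q}. cmod (a (i - k)) * y i)\<^sup>2)
       \<le> C * (\<Sum>i\<le>q. ((\<Sum>j\<le>i. cmod (a j)) * y i)\<^sup>2)"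
proof -
  obtain C where C: "\<And>u n. finite {j. u j \<noteq> 0} \<Longrightarrow>
      (\<Sum>i<n. (cmod (norlund_apply (\<lambda>n. complex_of_real (cmod (a n))) u i))\<^sup>2)
        \<le> C\<^sup>2 * (\<Sum>j\<in>{j. u j \<noteq> 0}. (cmod (u j))\<^sup>2)"
    using assms unfolding norlund_bounded_def by blast
  define A where "A i = (\<Sum>j\<le>i. cmod (a j))" for i
  define e where "e i j = (if j \<le> i \<and> A i > 0 then cmod (a (i - j)) / A i else 0)" for i j
  have entry: "norlund_entry (\<lambda>n. complex_of_real (cmod (a n))) i j = complex_of_real (e i j)" for i j
    by (simp add: norlund_entry_def norlund_B_def e_def A_def)
  \<comment> \<open>If \<open>A i = 0\<close>, the entry is 0 by convention, but then all
    coefficients up to \<open>i\<close> vanish too, so the identity persists.\<close>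
  have eA: "e i k * A i = cmod (a (i - k))" if "k \<le> i" for i k
  proof (cases "A i > 0")
    case False
    have "cmod (a (i - k)) \<le> A i"
      unfolding A_def by (rule member_le_sum) auto
    then have "cmod (a (i - k)) = 0" using False norm_ge_zero[of "a (i - k)"] by linarith
    then show ?thesis using False by (simp add: e_def)
  qed (use that in \<open>simp add: e_def\<close>)
  have "(\<Sum>k\<le>q. (\<Sum>i\<in>{k..q}. cmod (a (i - k)) * y i)\<^sup>2) \<le> C\<^sup>2 * (\<Sum>i\<le>q. (A i * y i)\<^sup>2)"
    (is "?L \<le> _ * ?R") for q and y :: "nat \<Rightarrow> real"
  proof -
    define w where "w k = (\<Sum>i\<le>q. e i k * (A i * y i))" for k
    have w: "w k = (\<Sum>i\<in>{k..q}. cmod (a (i - k)) * y i)" if "k \<le> q" for k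
    proof -
      have "w k = (\<Sum>i\<in>{k..q}. e i k * (A i * y i))"
        unfolding w_def by (rule sum.mono_neutral_right) (auto simp: e_def)
      also have "\<dots> = (\<Sum>i\<in>{k..q}. cmod (a (i - k)) * y i)"
        by (intro sum.cong refl) (simp add: eA flip: mult.assoc)
      finally show ?thesis .
    qed
    have L: "?L = (\<Sum>k\<le>q. (w k)\<^sup>2)"
      by (intro sum.cong refl) (simp add: w)
    \<comment> \<open>The test vector is \<open>w\<close> itself, cut off after \<open>q\<close>
      because boundedness is formulated for finitely supported vectors.\<close>
    define u where "u k = (if k \<le> q then complex_of_real (w k) else 0)" for k
    have fin: "finite {j. u j \<noteq> 0}"
      by (rule finite_subset[of _ "{..q}"]) (auto simp: u_def)
    have apply_u: "norlund_apply (\<lambda>n. complex_of_real (cmod (a n))) u i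
        = complex_of_real (\<Sum>k\<le>q. e i k * w k)" if "i \<le> q" for i
    proof -
      have "norlund_apply (\<lambda>n. complex_of_real (cmod (a n))) u i = (\<Sum>j\<le>i. complex_of_real (e i j * w j))"
        unfolding norlund_apply_def entry using that by (intro sum.cong refl) (simp add: u_def)
      also have "\<dots> = (\<Sum>j\<le>q. complex_of_real (e i j * w j))"
        using that by (intro sum.mono_neutral_left) (auto simp: e_def)
      finally show ?thesis by simp
    qed
    have "(\<Sum>i\<le>q. (\<Sum>k\<le>q. e i k * w k)\<^sup>2)
        = (\<Sum>i<Suc q. (cmod (norlund_apply (\<lambda>n. complex_of_real (cmod (a n))) u i))\<^sup>2)"
      by (intro sum.cong) (auto simp: apply_u simp del: of_real_sum)
    also have "\<dots> \<le> C\<^sup>2 * (\<Sum>j\<in>{j. u j \<noteq> 0}. (cmod (u j))\<^sup>2)"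
      by (rule C[OF fin])
    also have "(\<Sum>j\<in>{j. u j \<noteq> 0}. (cmod (u j))\<^sup>2) = (\<Sum>j\<le>q. (cmod (u j))\<^sup>2)"
      by (rule sum.mono_neutral_left) (auto simp: u_def)
    also have "\<dots> = ?L"
      unfolding L by (intro sum.cong refl) (simp add: u_def)
    finally have Nw: "(\<Sum>i\<le>q. (\<Sum>k\<le>q. e i k * w k)\<^sup>2) \<le> C\<^sup>2 * ?L" .
    have "?L = (\<Sum>k\<le>q. \<Sum>i\<le>q. e i k * (A i * y i) * w k)"
      unfolding L by (intro sum.cong refl) (simp add: w_def power2_eq_square sum_distrib_right)
    also have "\<dots> = (\<Sum>i\<le>q. \<Sum>k\<le>q. e i k * (A i * y i) * w k)"
      by (rule sum.swap)
    also have "\<dots> = (\<Sum>i\<le>q. (A i * y i) * (\<Sum>k\<le>q. e i k * w k))"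
      by (simp add: sum_distrib_left mult_ac)
    finally have "?L\<^sup>2 \<le> ?R * (\<Sum>i\<le>q. (\<Sum>k\<le>q. e i k * w k)\<^sup>2)"
      by (simp only: Cauchy_Schwarz_ineq_sum)
    also have "\<dots> \<le> ?R * (C\<^sup>2 * ?L)"
      by (intro mult_left_mono Nw sum_nonneg) auto
    finally have "?L * ?L \<le> (C\<^sup>2 * ?R) * ?L"
      by (simp add: power2_eq_square mult_ac)
    moreover have "?L \<ge> 0" "?R \<ge> 0"
      by (auto intro!: sum_nonneg)
    ultimately show ?thesis
      by (cases "?L = 0") (auto simp: mult_le_cancel_right)
  qed
  then show ?thesis
    by (intro exI[of _ "C\<^sup>2"]) (simp add: A_def)
qed

section \<open>Norm estimates for blocks of the series\<close>

text \<open>The squared norm is telescoped into the defects of P^k h for k < q and a last term.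
  Indices with n + k \<le> q are controlled by the transposed matrix, those beyond \<open>q\<close>
  by a second telescoping, and the last term by the triangle inequality. The latter two cost A_q^2
  |P^q f|^2 each, with factors 2 and 1, hence the constant 3.\<close>

lemma block_estimate:
  assumes P: "L2_contraction M P" and f: "L2_mem M f" and "C \<ge> 0" and
    N: "\<And>q (y :: nat \<Rightarrow> real). (\<Sum>k\<le>q. (\<Sum>i\<in>{k..q}. cmod (a (i - k)) * y i)\<^sup>2)
       \<le> C * (\<Sum>i\<le>q. ((\<Sum>j\<le>i. cmod (a j)) * y i)\<^sup>2)"
  shows "(L2_norm M (\<lambda>x. \<Sum>n\<in>{p<..q}. a n * (P ^^ n) f x))\<^sup>2
    \<le> 2 * C * (\<Sum>i\<in>{p<..q}. (\<Sum>j\<le>i. cmod (a j))\<^sup>2 * defect M P ((P ^^ i) f))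
      + 3 * (\<Sum>j\<le>q. cmod (a j))\<^sup>2 * (L2_norm M ((P ^^ q) f))\<^sup>2"
proof -
  define A where "A i = (\<Sum>j\<le>i. cmod (a j))" for i
  define h where "h = (\<lambda>x. \<Sum>n\<in>{p<..q}. a n * (P ^^ n) f x)"
  define x where "x n = L2_norm M ((P ^^ n) f)" for n
  define y where "y n = sqrt (defect M P ((P ^^ n) f))" for n
  note mem = L2_contraction_funpow_mem[OF P f]
  have h: "L2_mem M h"
    unfolding h_def by (rule L2_mem_sum) (auto simp: mem)
  have y2: "(y n)\<^sup>2 = defect M P ((P ^^ n) f)" for n
    using defect_nonneg[OF P mem] by (simp add: y_def)
  have y2_x: "(y n)\<^sup>2 = (x n)\<^sup>2 - (x (Suc n))\<^sup>2" for n
    unfolding y2 by (simp add: defect_def x_def)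
  have y0: "y n \<ge> 0" for n
    using defect_nonneg[OF P mem] by (simp add: y_def)
  have A0: "A n \<ge> 0" for n
    by (auto simp: A_def intro: sum_nonneg)
  have x0: "x n \<ge> 0" for n
    by (simp add: x_def L2_norm_nonneg)
  have block_A: "(\<Sum>n\<in>{p<..q}. cmod (a n)) \<le> A q"
    unfolding A_def by (rule sum_mono2) auto
  have Pk: "AE z in M. (P ^^ k) h z = (\<Sum>n\<in>{p<..q}. a n * (P ^^ (n + k)) f z)" for k
  proof -
    have "AE z in M. (P ^^ k) h z = (\<Sum>n\<in>{p<..q}. a n * (P ^^ k) ((P ^^ n) f) z)"
      unfolding h_def by (rule L2_contraction_funpow_sum[OF P]) (auto simp: mem)
    then show ?thesis
      by (simp only: add.commute[of _ k] funpow_add o_apply)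
  qed
  have mem_sum: "L2_mem M (\<lambda>z. \<Sum>n\<in>{p<..q}. a n * (P ^^ (n + k)) f z)" for k
    by (rule L2_mem_sum) (auto simp: mem)

  \<comment> \<open>The indices \<open>n + k > q\<close> are split off so that the final bound involves only defects with
    \<open>p < i \<le> q\<close>, and is therefore additive over consecutive blocks.\<close>
  define T1 where "T1 k = (\<Sum>n\<in>{n\<in>{p<..q}. n + k \<le> q}. cmod (a n) * y (n + k))" for k
  define T2 where "T2 k = (\<Sum>n\<in>{n\<in>{p<..q}. q < n + k}. cmod (a n) * y (n + k))" for k

  have defect_le: "defect M P ((P ^^ k) h) \<le> 2 * (T1 k)\<^sup>2 + 2 * (T2 k)\<^sup>2" for k
  proof -
    have "sqrt (defect M P ((P ^^ k) h)) = sqrt (defect M P (\<lambda>z. \<Sum>n\<in>{p<..q}. a n * (P ^^ (n + k)) f z))"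
      using defect_cong_AE[OF P L2_contraction_funpow_mem[OF P h] mem_sum Pk] by simp
    also have "\<dots> \<le> (\<Sum>n\<in>{p<..q}. cmod (a n) * y (n + k))"
      unfolding y_def by (rule defect_sum[OF P]) (auto simp: mem)
    also have "\<dots> = T1 k + T2 k"
      unfolding T1_def T2_def
      by (subst sum.union_disjoint[symmetric]) (auto intro!: sum.cong)
    finally have "defect M P ((P ^^ k) h) \<le> (T1 k + T2 k)\<^sup>2"
      by (rule sqrt_le_D)
    also have "\<dots> \<le> 2 * (T1 k)\<^sup>2 + 2 * (T2 k)\<^sup>2"
      using sum_squares_bound[of "T1 k" "T2 k"] by (simp add: power2_sum)
    finally show ?thesis .
  qed

  have T1: "(\<Sum>k<q. (T1 k)\<^sup>2) \<le> C * (\<Sum>i\<in>{p<..q}. (A i)\<^sup>2 * (y i)\<^sup>2)"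
  proof -
    \<comment> \<open>Setting the vector to 0 up to \<open>p\<close> keeps the right-hand side
      inside the block. Nothing is lost on the left, because i = n + k \<ge> n > p.\<close>
    define y' where "y' i = (if p < i then y i else 0)" for i
    have "T1 k \<le> (\<Sum>i\<in>{k..q}. cmod (a (i - k)) * y' i)" for k
    proof -
      have "T1 k = (\<Sum>i\<in>(\<lambda>n. n + k) ` {n\<in>{p<..q}. n + k \<le> q}. cmod (a (i - k)) * y' i)"
        unfolding T1_def by (subst sum.reindex) (auto simp: y'_def)
      also have "\<dots> \<le> (\<Sum>i\<in>{k..q}. cmod (a (i - k)) * y' i)"
        by (rule sum_mono2) (auto simp: y'_def y0)
      finally show ?thesis .
    qed
    moreover have "T1 k \<ge> 0" for k
      unfolding T1_def by (auto intro!: sum_nonneg simp: y0)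
    ultimately have "(\<Sum>k<q. (T1 k)\<^sup>2) \<le> (\<Sum>k<q. (\<Sum>i\<in>{k..q}. cmod (a (i - k)) * y' i)\<^sup>2)"
      by (intro sum_mono power_mono) auto
    also have "\<dots> \<le> (\<Sum>k\<le>q. (\<Sum>i\<in>{k..q}. cmod (a (i - k)) * y' i)\<^sup>2)"
      by (rule sum_mono2) auto
    also have "\<dots> \<le> C * (\<Sum>i\<le>q. (A i * y' i)\<^sup>2)"
      unfolding A_def by (rule N)
    also have "(\<Sum>i\<le>q. (A i * y' i)\<^sup>2) = (\<Sum>i\<in>{p<..q}. (A i * y' i)\<^sup>2)"
      by (rule sum.mono_neutral_right) (auto simp: y'_def)
    also have "\<dots> = (\<Sum>i\<in>{p<..q}. (A i)\<^sup>2 * (y i)\<^sup>2)"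
      by (intro sum.cong refl) (auto simp: y'_def power_mult_distrib)
    finally show ?thesis .
  qed

  have T2: "(\<Sum>k<q. (T2 k)\<^sup>2) \<le> (A q)\<^sup>2 * (x q)\<^sup>2"
  proof -
    \<comment> \<open>Cauchy-Schwarz with |a_n| split into two square roots: one factor sums to at
      most A_q, the other keeps |a_n| as a weight. After exchanging sums, the sum over
      \<open>k\<close> can be telescoped for each fixed \<open>n\<close>.\<close>
    have "(T2 k)\<^sup>2 \<le> A q * (\<Sum>n\<in>{p<..q}. cmod (a n) * (if q < n + k then (y (n + k))\<^sup>2 else 0))" for k
    proof -
      let ?F = "{n\<in>{p<..q}. q < n + k}"
      have "T2 k = (\<Sum>n\<in>?F. sqrt (cmod (a n)) * (sqrt (cmod (a n)) * y (n + k)))"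
        unfolding T2_def by (intro sum.cong refl) (simp flip: mult.assoc)
      then have "(T2 k)\<^sup>2 \<le> (\<Sum>n\<in>?F. (sqrt (cmod (a n)))\<^sup>2) * (\<Sum>n\<in>?F. (sqrt (cmod (a n)) * y (n + k))\<^sup>2)"
        by (simp only: Cauchy_Schwarz_ineq_sum)
      also have "\<dots> = (\<Sum>n\<in>?F. cmod (a n)) * (\<Sum>n\<in>?F. cmod (a n) * (y (n + k))\<^sup>2)"
        by (simp add: power_mult_distrib)
      also have "\<dots> \<le> A q * (\<Sum>n\<in>?F. cmod (a n) * (y (n + k))\<^sup>2)"
        unfolding A_def by (intro mult_right_mono sum_mono2 sum_nonneg) auto
      also have "(\<Sum>n\<in>?F. cmod (a n) * (y (n + k))\<^sup>2)
          = (\<Sum>n\<in>{p<..q}. cmod (a n) * (if q < n + k then (y (n + k))\<^sup>2 else 0))"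
        by (rule sum.mono_neutral_cong_left) auto
      finally show ?thesis .
    qed
    then have "(\<Sum>k<q. (T2 k)\<^sup>2)
        \<le> (\<Sum>k<q. A q * (\<Sum>n\<in>{p<..q}. cmod (a n) * (if q < n + k then (y (n + k))\<^sup>2 else 0)))"
      by (rule sum_mono)
    also have "\<dots> = A q * (\<Sum>n\<in>{p<..q}. cmod (a n) * (\<Sum>k<q. if q < n + k then (y (n + k))\<^sup>2 else 0))"
      unfolding sum_distrib_left by (rule sum.swap)
    also have "\<dots> \<le> A q * (\<Sum>n\<in>{p<..q}. cmod (a n) * (x q)\<^sup>2)"
    proof (intro mult_left_mono sum_mono A0 norm_ge_zero)
      fix n assume n: "n \<in> {p<..q}"
      have "(\<Sum>k<q. if q < n + k then (y (n + k))\<^sup>2 else 0) = (\<Sum>k\<in>{k\<in>{..<q}. q < n + k}. (y (n + k))\<^sup>2)"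
        by (rule sum.inter_filter[symmetric]) simp
      also have "\<dots> = (\<Sum>i\<in>(\<lambda>k. n + k) ` {k\<in>{..<q}. q < n + k}. (y i)\<^sup>2)"
        by (subst sum.reindex) auto
      also have "\<dots> \<le> (\<Sum>i\<in>{q..<n + q}. (y i)\<^sup>2)"
        by (rule sum_mono2) auto
      \<comment> \<open>The squares y_i^2 are differences of consecutive x_i^2, so the tail beyond
        \<open>q\<close> costs at most x_q^2, whatever its length.\<close>
      also have "\<dots> = (x q)\<^sup>2 - (x (n + q))\<^sup>2"
        unfolding y2_x using sum_Suc_diff'[of q "n + q" "\<lambda>i. - (x i)\<^sup>2"] by simp
      finally show "(\<Sum>k<q. if q < n + k then (y (n + k))\<^sup>2 else 0) \<le> (x q)\<^sup>2"
        using zero_le_power2[of "x (n + q)"] by linarith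
    qed
    also have "\<dots> = A q * ((\<Sum>n\<in>{p<..q}. cmod (a n)) * (x q)\<^sup>2)"
      by (simp add: sum_distrib_right)
    also have "\<dots> \<le> A q * (A q * (x q)\<^sup>2)"
      by (intro mult_left_mono mult_right_mono block_A A0) auto
    finally show ?thesis by (simp add: power2_eq_square)
  qed

  have last: "(L2_norm M ((P ^^ q) h))\<^sup>2 \<le> (A q)\<^sup>2 * (x q)\<^sup>2"
  proof -
    have "L2_norm M ((P ^^ q) h) = L2_norm M (\<lambda>z. \<Sum>n\<in>{p<..q}. a n * (P ^^ (n + q)) f z)"
      by (rule L2_norm_cong_AE[OF L2_contraction_funpow_mem[OF P h] mem_sum Pk])
    also have "\<dots> \<le> (\<Sum>n\<in>{p<..q}. cmod (a n) * L2_norm M ((P ^^ (n + q)) f))"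
      by (rule L2_norm_sum) (auto simp: mem)
    also have "\<dots> \<le> (\<Sum>n\<in>{p<..q}. cmod (a n) * x q)"
      unfolding x_def by (intro sum_mono mult_left_mono L2_contraction_funpow_antimono[OF P f]) auto
    also have "\<dots> = (\<Sum>n\<in>{p<..q}. cmod (a n)) * x q"
      by (simp add: sum_distrib_right)
    also have "\<dots> \<le> A q * x q"
      by (intro mult_right_mono block_A x0)
    finally have "(L2_norm M ((P ^^ q) h))\<^sup>2 \<le> (A q * x q)\<^sup>2"
      by (rule power_mono[OF _ L2_norm_nonneg])
    then show ?thesis by (simp add: power_mult_distrib)
  qed

  have "(L2_norm M h)\<^sup>2 = (\<Sum>k<q. defect M P ((P ^^ k) h)) + (L2_norm M ((P ^^ q) h))\<^sup>2"
    by (rule L2_norm_power2_eq_sum_defect)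
  also have "\<dots> \<le> (\<Sum>k<q. 2 * (T1 k)\<^sup>2 + 2 * (T2 k)\<^sup>2) + (A q)\<^sup>2 * (x q)\<^sup>2"
    by (intro add_mono sum_mono defect_le last)
  also have "\<dots> = 2 * (\<Sum>k<q. (T1 k)\<^sup>2) + 2 * (\<Sum>k<q. (T2 k)\<^sup>2) + (A q)\<^sup>2 * (x q)\<^sup>2"
    by (simp add: sum.distrib sum_distrib_left)
  also have "\<dots> \<le> 2 * (C * (\<Sum>i\<in>{p<..q}. (A i)\<^sup>2 * (y i)\<^sup>2)) + 3 * (A q)\<^sup>2 * (x q)\<^sup>2"
    using T1 T2 by linarith
  finally show ?thesis
    by (simp add: h_def A_def x_def y2)
qed

lemma sum_dyadic_blocks:
  fixes h :: "nat \<Rightarrow> 'a::comm_monoid_add"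
  assumes "s \<le> t"
  shows "(\<Sum>k\<in>{s..<t}. \<Sum>n\<in>{2^k<..2^Suc k}. h n) = (\<Sum>n\<in>{2^s<..2^t}. h n)"
  using assms
proof (induction t rule: dec_induct)
  case (step t)
  have "{2^s<..2^t} \<union> {2^t<..2^Suc t} = {2^s<..(2::nat)^Suc t}"
    using step by (intro ivl_disj_un_two(6)) auto
  then have "(\<Sum>n\<in>{2^s<..2^Suc t}. h n) = (\<Sum>n\<in>{2^s<..2^t}. h n) + (\<Sum>n\<in>{2^t<..2^Suc t}. h n)"
    by (subst sum.union_disjoint[symmetric]) auto
  then show ?case using step by simp
qed simp

text \<open>Within one dyadic block the weight A_i is at most its value at the right endpoint, and
  the defects telescope to at most |P^(2^k) f|^2; each block thus contributes c_k. The constant is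
  2C from the defects plus 3 from the end term.\<close>

lemma dyadic_block_estimate:
  assumes P: "L2_contraction M P" and f: "L2_mem M f"
    and "norlund_bounded (\<lambda>n. complex_of_real (cmod (a n)))"
  obtains K where "K \<ge> 0" and
    "\<And>s t. s < t \<Longrightarrow> (L2_norm M (\<lambda>x. \<Sum>n\<in>{2^s<..2^t}. a n * (P ^^ n) f x))\<^sup>2
      \<le> K * (\<Sum>k\<in>{s..<t}. (\<Sum>j\<le>2^(k+1). cmod (a j))\<^sup>2 * (L2_norm M ((P ^^ (2^k)) f))\<^sup>2)"
proof -
  obtain C :: real where C: "C \<ge> 0" and
    N: "\<And>q (y :: nat \<Rightarrow> real). (\<Sum>k\<le>q. (\<Sum>i\<in>{k..q}. cmod (a (i - k)) * y i)\<^sup>2)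
       \<le> C * (\<Sum>i\<le>q. ((\<Sum>j\<le>i. cmod (a j)) * y i)\<^sup>2)"
    using norlund_transpose_bound[OF assms(3)] by auto
  define A where "A i = (\<Sum>j\<le>i. cmod (a j))" for i
  define x where "x n = L2_norm M ((P ^^ n) f)" for n
  define c where "c k = (A (2^(k+1)))\<^sup>2 * (x (2^k))\<^sup>2" for k
  have A_mono: "A m \<le> A n" if "m \<le> n" for m n
    unfolding A_def using that by (intro sum_mono2) auto
  have A0: "A n \<ge> 0" for n
    by (auto simp: A_def intro: sum_nonneg)
  have x0: "x n \<ge> 0" for n
    by (simp add: x_def L2_norm_nonneg)
  have x_mono: "x n \<le> x m" if "m \<le> n" for m n
    unfolding x_def by (rule L2_contraction_funpow_antimono[OF P f that])
  have one: "(\<Sum>i\<in>{2^k<..2^Suc k}. (A i)\<^sup>2 * defect M P ((P ^^ i) f)) \<le> c k" for k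
  proof -
    have "(\<Sum>i\<in>{2^k<..2^Suc k}. (A i)\<^sup>2 * defect M P ((P ^^ i) f))
        \<le> (\<Sum>i\<in>{2^k<..2^Suc k}. (A (2^Suc k))\<^sup>2 * defect M P ((P ^^ i) f))"
      by (intro sum_mono mult_right_mono power_mono A_mono A0
          defect_nonneg[OF P] L2_contraction_funpow_mem[OF P f]) auto
    also have "\<dots> = (A (2^Suc k))\<^sup>2 * (\<Sum>i\<in>{Suc (2^k)..<Suc (2^Suc k)}. defect M P ((P ^^ i) f))"
      unfolding sum_distrib_left by (rule sum.cong) auto
    also have "(\<Sum>i\<in>{Suc (2^k)..<Suc (2^Suc k)}. defect M P ((P ^^ i) f))
        = (x (Suc (2^k)))\<^sup>2 - (x (Suc (2^Suc k)))\<^sup>2"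
      using sum_Suc_diff'[of "Suc (2^k)" "Suc (2^Suc k)" "\<lambda>i. - (x i)\<^sup>2"]
      by (simp add: defect_def x_def)
    also have "\<dots> \<le> (x (2^k))\<^sup>2"
      by (rule order_trans[of _ "(x (Suc (2^k)))\<^sup>2"]) (auto intro!: power_mono x_mono x0)
    finally show ?thesis
      by (simp add: c_def mult_left_mono)
  qed
  have many: "(\<Sum>i\<in>{2^s<..2^t}. (A i)\<^sup>2 * defect M P ((P ^^ i) f)) \<le> (\<Sum>k\<in>{s..<t}. c k)"
    if "s \<le> t" for s t
    unfolding sum_dyadic_blocks[OF that, symmetric] by (intro sum_mono one)
  have c0: "c k \<ge> 0" for k
    by (simp add: c_def)
  have "(L2_norm M (\<lambda>x. \<Sum>n\<in>{2^s<..2^t}. a n * (P ^^ n) f x))\<^sup>2 \<le> (2 * C + 3) * (\<Sum>k\<in>{s..<t}. c k)"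
    if "s < t" for s t
  proof -
    \<comment> \<open>The end term fits into the last summand: block \<open>t - 1\<close> has right
      endpoint 2^t, and the norms of the iterates decrease. This is where s < t enters.\<close>
    have "(A (2^t))\<^sup>2 * (x (2^t))\<^sup>2 \<le> c (t - 1)"
      using that unfolding c_def by (intro mult_mono power_mono x_mono x0 A0) auto
    also have "\<dots> \<le> (\<Sum>k\<in>{s..<t}. c k)"
      using that by (intro member_le_sum c0) auto
    finally have last: "(A (2^t))\<^sup>2 * (x (2^t))\<^sup>2 \<le> (\<Sum>k\<in>{s..<t}. c k)" .
    have "(L2_norm M (\<lambda>x. \<Sum>n\<in>{2^s<..2^t}. a n * (P ^^ n) f x))\<^sup>2
      \<le> 2 * C * (\<Sum>i\<in>{2^s<..2^t}. (A i)\<^sup>2 * defect M P ((P ^^ i) f)) + 3 * (A (2^t))\<^sup>2 * (x (2^t))\<^sup>2"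
      unfolding A_def x_def by (rule block_estimate[OF P f C N])
    also have "\<dots> \<le> 2 * C * (\<Sum>k\<in>{s..<t}. c k) + 3 * (\<Sum>k\<in>{s..<t}. c k)"
      using last many[of s t] that C by (intro add_mono mult_left_mono) auto
    finally show ?thesis by (simp add: algebra_simps)
  qed
  then show ?thesis
    using C that[of "2 * C + 3"] by (simp add: c_def A_def x_def)
qed

section \<open>Rademacher--Menshov\<close>

text \<open>Bisection: a partial sum of length at most 2^(r+1) either stays in the left half or is
  the full left half plus a partial sum of the right half. An explicit majorant \<open>W\<close>
  replaces the maximum over \<open>t\<close>, and \<open>orth\<close> serves as the substitute for
  orthogonality.\<close>

lemma rademacher_menshov_finite:
  fixes D :: "nat \<Rightarrow> 'a \<Rightarrow> complex" and c :: "nat \<Rightarrow> real"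
  assumes D: "\<And>k. L2_mem M (D k)" and c: "\<And>k. c k \<ge> 0"
    and orth: "\<And>s t. s < t \<Longrightarrow> (L2_norm M (\<lambda>x. \<Sum>k\<in>{s..<t}. D k x))\<^sup>2 \<le> (\<Sum>k\<in>{s..<t}. c k)"
  shows "\<exists>W. integrable M W \<and> (\<forall>x. 0 \<le> W x)
    \<and> (\<forall>x. \<forall>t\<le>2^r. (cmod (\<Sum>k\<in>{s..<s+t}. D k x))\<^sup>2 \<le> W x)
    \<and> (\<integral>x. W x \<partial>M) \<le> (real r + 1)\<^sup>2 * (\<Sum>k\<in>{s..<s+2^r}. c k)"
proof (induction r arbitrary: s)
  case 0
  have "integrable M (\<lambda>x. (cmod (D s x))\<^sup>2)"
    using D by (simp add: L2_mem_def)
  moreover have "(\<integral>x. (cmod (D s x))\<^sup>2 \<partial>M) \<le> c s"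
    using orth[of s "Suc s"] by (simp add: L2_norm_power2)
  ultimately show ?case
    by (intro exI[of _ "\<lambda>x. (cmod (D s x))\<^sup>2"]) (auto simp: le_Suc_eq)
next
  case (Suc r)
  define n where "n = real r + 1"
  have n: "n > 0" by (simp add: n_def)
  define p :: nat where "p = 2^r"
  obtain W1 where W1: "integrable M W1" "\<And>x. 0 \<le> W1 x"
      "\<And>x t. t \<le> p \<Longrightarrow> (cmod (\<Sum>k\<in>{s..<s+t}. D k x))\<^sup>2 \<le> W1 x"
      "(\<integral>x. W1 x \<partial>M) \<le> n\<^sup>2 * (\<Sum>k\<in>{s..<s+p}. c k)"
    using Suc.IH[of s] unfolding n_def p_def by blast
  obtain W2 where W2: "integrable M W2" "\<And>x. 0 \<le> W2 x"
      "\<And>x t. t \<le> p \<Longrightarrow> (cmod (\<Sum>k\<in>{s+p..<s+p+t}. D k x))\<^sup>2 \<le> W2 x"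
      "(\<integral>x. W2 x \<partial>M) \<le> n\<^sup>2 * (\<Sum>k\<in>{s+p..<s+p+p}. c k)"
    using Suc.IH[of "s+p"] unfolding n_def p_def by blast
  define S where "S x = (\<Sum>k\<in>{s..<s+p}. D k x)" for x
  \<comment> \<open>The two weights form the pair in Young's inequality for which the constant n^2
    grows to exactly (n + 1)^2.\<close>
  define W where "W x = (n + 1) * (cmod (S x))\<^sup>2 + (n + 1) / n * (W1 x + W2 x)" for x
  have "L2_mem M S"
    using L2_mem_sum[of "{s..<s+p}" M D "\<lambda>_. 1"] D by (simp add: S_def[abs_def])
  then have S_int: "integrable M (\<lambda>x. (cmod (S x))\<^sup>2)"
    by (simp add: L2_mem_def)
  have W_nonneg: "0 \<le> W x" for x
    using n W1(2)[of x] W2(2)[of x] by (simp add: W_def)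
  have bound: "(cmod (\<Sum>k\<in>{s..<s+t}. D k x))\<^sup>2 \<le> W x" if t: "t \<le> 2^Suc r" for x t
  proof (cases "t \<le> p")
    case True
    have "W1 x * 1 \<le> (W1 x + W2 x) * ((n + 1) / n)"
      using n W1(2)[of x] W2(2)[of x] by (intro mult_mono) auto
    also have "\<dots> \<le> W x"
      using n by (simp add: W_def mult.commute)
    finally show ?thesis using W1(3)[OF True, of x] by simp
  next
    case False
    define R where "R = (\<Sum>k\<in>{s+p..<s+p+(t-p)}. D k x)"
    have young: "(u + v)\<^sup>2 \<le> (n + 1) * u\<^sup>2 + (n + 1) / n * v\<^sup>2" for u v :: real
    proof -
      have "(n + 1) * u\<^sup>2 + (n + 1) / n * v\<^sup>2 - (u + v)\<^sup>2 = (n * u - v)\<^sup>2 / n"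
        using n by (simp add: field_simps power2_eq_square)
      also have "\<dots> \<ge> 0" using n by simp
      finally show ?thesis by simp
    qed
    have "(\<Sum>k\<in>{s..<s+t}. D k x) = S x + R"
      unfolding S_def R_def using False by (subst sum.atLeastLessThan_concat) auto
    then have "(cmod (\<Sum>k\<in>{s..<s+t}. D k x))\<^sup>2 \<le> (cmod (S x) + cmod R)\<^sup>2"
      by (simp add: norm_triangle_ineq power_mono)
    also have "\<dots> \<le> (n + 1) * (cmod (S x))\<^sup>2 + (n + 1) / n * (cmod R)\<^sup>2"
      by (rule young)
    also have "\<dots> \<le> (n + 1) * (cmod (S x))\<^sup>2 + (n + 1) / n * (W1 x + W2 x)"
    proof -
      have "t - p \<le> p" using t by (simp add: p_def)
      from W2(3)[OF this, of x] W1(2)[of x] have "(cmod R)\<^sup>2 \<le> W1 x + W2 x"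
        by (simp add: R_def)
      then show ?thesis using n by (intro add_left_mono mult_left_mono) auto
    qed
    finally show ?thesis by (simp add: W_def)
  qed
  have W_int: "integrable M W"
    unfolding W_def using S_int W1(1) W2(1) by simp
  have "(\<integral>x. W x \<partial>M) = (n + 1) * (L2_norm M S)\<^sup>2 + (n + 1) / n * ((\<integral>x. W1 x \<partial>M) + (\<integral>x. W2 x \<partial>M))"
    unfolding W_def L2_norm_power2 using S_int W1(1) W2(1) by simp
  also have "\<dots> \<le> (n + 1) * (\<Sum>k\<in>{s..<s+p+p}. c k) + (n + 1) / n * (n\<^sup>2 * (\<Sum>k\<in>{s..<s+p+p}. c k))"
  proof (intro add_mono mult_left_mono)
    have "(L2_norm M S)\<^sup>2 \<le> (\<Sum>k\<in>{s..<s+p}. c k)"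
      using orth[of s "s+p"] by (simp add: S_def[abs_def] p_def)
    also have "\<dots> \<le> (\<Sum>k\<in>{s..<s+p+p}. c k)"
      using c by (intro sum_mono2) auto
    finally show "(L2_norm M S)\<^sup>2 \<le> (\<Sum>k\<in>{s..<s+p+p}. c k)" .
    have "(\<integral>x. W1 x \<partial>M) + (\<integral>x. W2 x \<partial>M)
        \<le> n\<^sup>2 * ((\<Sum>k\<in>{s..<s+p}. c k) + (\<Sum>k\<in>{s+p..<s+p+p}. c k))"
      using W1(4) W2(4) by (simp add: algebra_simps)
    then show "(\<integral>x. W1 x \<partial>M) + (\<integral>x. W2 x \<partial>M) \<le> n\<^sup>2 * (\<Sum>k\<in>{s..<s+p+p}. c k)"
      by (simp add: sum.atLeastLessThan_concat)
  qed (use n in auto)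
  \<comment> \<open>Indeed (n + 1) + ((n + 1) / n) n^2 = (n + 1)^2.\<close>
  also have "\<dots> = (n + 1)\<^sup>2 * (\<Sum>k\<in>{s..<s+p+p}. c k)"
    using n by (simp add: field_simps power2_eq_square)
  finally have "(\<integral>x. W x \<partial>M) \<le> (real (Suc r) + 1)\<^sup>2 * (\<Sum>k\<in>{s..<s+2^Suc r}. c k)"
    by (simp add: n_def p_def add.commute add.left_commute mult_2)
  then show ?case
    using W_int W_nonneg bound by blast
qed

section \<open>Logarithmic weights and the maximal inequality for infinite sums\<close>

lemma sum_dyadic_intervals:
  fixes h :: "nat \<Rightarrow> 'a::comm_monoid_add"
  shows "(\<Sum>r<R. \<Sum>k\<in>{2^r..<2^Suc r}. h k) = (\<Sum>k\<in>{1..<2^R}. h k)"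
  by (induction R) (simp_all add: sum.atLeastLessThan_concat)

text \<open>For k \<ge> 2^r and k \<ge> 1, both r ln 2 and ln 2 are at most ln (k + 1), so r + 1
  \<le> (2 / ln 2) ln (k + 1). The factor (r + 1)^2 lost on a dyadic interval is thus paid for by
  the squared logarithm.\<close>

lemma summable_dyadic_blocks_of_log_weighted:
  fixes c :: "nat \<Rightarrow> real"
  assumes c: "\<And>k. c k \<ge> 0"
    and "summable (\<lambda>k. if k \<ge> 1 then (ln (real k + 1))\<^sup>2 * c k else 0)"
  shows "summable (\<lambda>r. (real r + 1)\<^sup>2 * (\<Sum>k\<in>{2^r..<2^Suc r}. c k))"
proof -
  define w where "w k = (if k \<ge> 1 then (ln (real k + 1))\<^sup>2 * c k else 0)" for k
  define B where "B = (2 / ln 2 :: real)\<^sup>2"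
  have w: "summable w" using assms(2) by (simp add: w_def[abs_def])
  have w0: "w k \<ge> 0" for k using c by (simp add: w_def)
  have le: "(real r + 1)\<^sup>2 * c k \<le> B * w k" if "k \<ge> 2^r" for r k
  proof -
    have "k \<ge> 1" using that one_le_power[of "2::nat" r] by linarith
    have "real k \<ge> 2^r" using that by simp
    then have "2^r \<le> real k + 1" by linarith
    then have "ln (2^r) \<le> ln (real k + 1)"
      by (intro ln_mono) auto
    then have "real r * ln 2 \<le> ln (real k + 1)"
      by (simp add: ln_realpow)
    moreover have "ln 2 \<le> ln (real k + 1)"
      using \<open>k \<ge> 1\<close> by (intro ln_mono) auto
    ultimately have "(real r + 1) * ln 2 \<le> 2 * ln (real k + 1)"
      unfolding distrib_right by linarith
    then have "real r + 1 \<le> 2 / ln 2 * ln (real k + 1)"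
      by (simp add: field_simps)
    then have "(real r + 1)\<^sup>2 \<le> B * (ln (real k + 1))\<^sup>2"
      unfolding B_def power_mult_distrib[symmetric] by (intro power_mono) auto
    then show ?thesis
      using \<open>k \<ge> 1\<close> c[of k] mult_right_mono[of _ _ "c k"] by (simp add: w_def mult.assoc[symmetric])
  qed
  have "(\<Sum>r<R. (real r + 1)\<^sup>2 * (\<Sum>k\<in>{2^r..<2^Suc r}. c k)) \<le> B * suminf w" for R
  proof -
    have "(\<Sum>r<R. (real r + 1)\<^sup>2 * (\<Sum>k\<in>{2^r..<2^Suc r}. c k))
        \<le> (\<Sum>r<R. B * (\<Sum>k\<in>{2^r..<2^Suc r}. w k))"
      unfolding sum_distrib_left by (intro sum_mono le) auto
    also have "\<dots> = B * (\<Sum>k\<in>{1..<2^R}. w k)"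
      by (simp only: sum_dyadic_intervals flip: sum_distrib_left)
    also have "\<dots> \<le> B * suminf w"
      by (intro mult_left_mono sum_le_suminf w) (auto simp: w0 B_def)
    finally show ?thesis .
  qed
  then show ?thesis
    using c by (intro summableI_nonneg_bounded[where x = "B * suminf w"] mult_nonneg_nonneg sum_nonneg) auto
qed

text \<open>Cauchy-Schwarz against the sequence 1/(r + 1), whose squares sum to pi^2/6.\<close>

lemma summable_of_weighted_squares:
  fixes e :: "nat \<Rightarrow> real"
  assumes e: "\<And>r. e r \<ge> 0" and sm: "summable (\<lambda>r. (real r + 1)\<^sup>2 * (e r)\<^sup>2)"
  shows "summable e" and "(suminf e)\<^sup>2 \<le> pi\<^sup>2 / 6 * (\<Sum>r. (real r + 1)\<^sup>2 * (e r)\<^sup>2)"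
proof -
  define B where "B = pi\<^sup>2 / 6 * (\<Sum>r. (real r + 1)\<^sup>2 * (e r)\<^sup>2)"
  have B: "B \<ge> 0"
    unfolding B_def by (intro mult_nonneg_nonneg suminf_nonneg sm) auto
  have bound: "(\<Sum>r<R. e r) \<le> sqrt B" for R
  proof -
    have "(\<Sum>r<R. e r)\<^sup>2 = (\<Sum>r<R. (1 / (real r + 1)) * ((real r + 1) * e r))\<^sup>2"
      by (intro arg_cong[where f = "\<lambda>x. x\<^sup>2"] sum.cong refl) (simp add: add_nonneg_eq_0_iff)
    also have "\<dots> \<le> (\<Sum>r<R. (1 / (real r + 1))\<^sup>2) * (\<Sum>r<R. ((real r + 1) * e r)\<^sup>2)"
      by (rule Cauchy_Schwarz_ineq_sum)
    also have "\<dots> \<le> B"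
      unfolding B_def
    proof (intro mult_mono)
      show "(\<Sum>r<R. (1 / (real r + 1))\<^sup>2) \<le> pi\<^sup>2 / 6"
        using sum_le_suminf[OF sums_summable[OF inverse_squares_sums], of "{..<R}"]
          sums_unique[OF inverse_squares_sums] by (simp add: power_divide add.commute)
      show "(\<Sum>r<R. ((real r + 1) * e r)\<^sup>2) \<le> (\<Sum>r. (real r + 1)\<^sup>2 * (e r)\<^sup>2)"
        unfolding power_mult_distrib by (intro sum_le_suminf sm) auto
    qed (auto intro!: sum_nonneg)
    finally show ?thesis by (rule real_le_rsqrt)
  qed
  show "summable e"
    by (rule summableI_nonneg_bounded[OF e bound])
  then have "suminf e \<le> sqrt B"
    by (intro suminf_le_const bound)
  then have "(suminf e)\<^sup>2 \<le> (sqrt B)\<^sup>2"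
    by (intro power_mono suminf_nonneg \<open>summable e\<close> e)
  then show "(suminf e)\<^sup>2 \<le> pi\<^sup>2 / 6 * (\<Sum>r. (real r + 1)\<^sup>2 * (e r)\<^sup>2)"
    using B by (simp add: B_def)
qed

lemma ex_dyadic_block:
  fixes n :: nat
  assumes "n \<ge> 1"
  obtains r where "2^r \<le> n" "n < 2^Suc r"
  using ex_power_ivl1[of 2 n] assms by auto

text \<open>Convergence along powers of two extends to the whole sequence once the oscillation
  inside the blocks tends to 0.\<close>

lemma convergent_of_dyadic_blocks:
  fixes s :: "nat \<Rightarrow> complex"
  assumes "convergent (\<lambda>r. s (2^r))" and m: "m \<longlonglongrightarrow> 0"
    and le: "\<And>r n. 2^r \<le> n \<Longrightarrow> n < 2^Suc r \<Longrightarrow> cmod (s n - s (2^r)) \<le> m r"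
  shows "convergent s"
proof -
  obtain l where l: "(\<lambda>r. s (2^r)) \<longlonglongrightarrow> l"
    using assms(1) by (auto simp: convergent_def)
  have "s \<longlonglongrightarrow> l"
  proof (rule LIMSEQ_I)
    fix e :: real assume "e > 0"
    then obtain R1 where R1: "\<And>r. r \<ge> R1 \<Longrightarrow> norm (s (2^r) - l) < e / 2"
      using LIMSEQ_D[OF l, of "e / 2"] by auto
    obtain R2 where R2: "\<And>r. r \<ge> R2 \<Longrightarrow> norm (m r - 0) < e / 2"
      using LIMSEQ_D[OF m, of "e / 2"] \<open>e > 0\<close> by auto
    define R where "R = max R1 R2"
    have "norm (s n - l) < e" if n: "n \<ge> 2^R" for n
    proof -
      have "n \<ge> 1" using n one_le_power[of "2::nat" R] by linarith
      then obtain r where r: "2^r \<le> n" "n < 2^Suc r" by (rule ex_dyadic_block)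
      have "(2::nat)^R < 2^Suc r" using r n by linarith
      then have "R < Suc r" by (rule power_less_imp_less_exp[rotated]) simp
      then have "r \<ge> R1" "r \<ge> R2" by (auto simp: R_def)
      have "norm (s n - l) \<le> norm (s n - s (2^r)) + norm (s (2^r) - l)"
        using norm_triangle_ineq[of "s n - s (2^r)" "s (2^r) - l"] by simp
      also have "\<dots> < e"
        using le[OF r] R1[OF \<open>r \<ge> R1\<close>] R2[OF \<open>r \<ge> R2\<close>] by simp
      finally show ?thesis .
    qed
    then show "\<exists>no. \<forall>n\<ge>no. norm (s n - l) < e" by blast
  qed
  then show ?thesis by (auto simp: convergent_def)
qed

text \<open>Sums up to powers of two converge absolutely because the blocks \<open>E r\<close> are
  square summable with weight (r + 1)^2; between such powers the finite inequality gives the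
  majorant \<open>W r\<close>. Sums start at index 1, where the intervals [2^r, 2^(r+1)) start; the
  logarithmic weight vanishes at index 0.\<close>

lemma rademacher_menshov:
  fixes D :: "nat \<Rightarrow> 'a \<Rightarrow> complex" and c :: "nat \<Rightarrow> real"
  assumes D: "\<And>k. L2_mem M (D k)" and c: "\<And>k. c k \<ge> 0"
    and orth: "\<And>s t. s < t \<Longrightarrow> (L2_norm M (\<lambda>x. \<Sum>k\<in>{s..<t}. D k x))\<^sup>2 \<le> (\<Sum>k\<in>{s..<t}. c k)"
    and sm: "summable (\<lambda>k. if k \<ge> 1 then (ln (real k + 1))\<^sup>2 * c k else 0)"
  obtains G where "G \<in> borel_measurable M" "(\<integral>\<^sup>+x. G x \<partial>M) < \<infinity>"
    "\<And>x. G x < \<infinity> \<Longrightarrow> convergent (\<lambda>n. \<Sum>k\<in>{1..<n}. D k x)"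
    "\<And>x n. ennreal ((cmod (\<Sum>k\<in>{1..<n}. D k x))\<^sup>2) \<le> G x"
proof -
  have "\<forall>r. \<exists>W. integrable M W \<and> (\<forall>x. 0 \<le> W x)
    \<and> (\<forall>x. \<forall>t\<le>2^r. (cmod (\<Sum>k\<in>{2^r..<2^r+t}. D k x))\<^sup>2 \<le> W x)
    \<and> (\<integral>x. W x \<partial>M) \<le> (real r + 1)\<^sup>2 * (\<Sum>k\<in>{2^r..<2^r+2^r}. c k)"
    using rademacher_menshov_finite[of M D c, OF D c orth] by blast
  then obtain W where W: "\<And>r. integrable M (W r)" "\<And>r x. 0 \<le> W r x"
      "\<And>r x t. t \<le> 2^r \<Longrightarrow> (cmod (\<Sum>k\<in>{2^r..<2^r+t}. D k x))\<^sup>2 \<le> W r x"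
      "\<And>r. (\<integral>x. W r x \<partial>M) \<le> (real r + 1)\<^sup>2 * (\<Sum>k\<in>{2^r..<2^r+2^r}. c k)"
    by metis
  define E where "E r x = (\<Sum>k\<in>{2^r..<2^Suc r}. D k x)" for r x
  \<comment> \<open>The factor 6 is 2 from splitting |u + v|^2 times 3 as a crude upper bound for
    pi^2/6; it also covers the factor 2 in front of \<open>W\<close>.\<close>
  define g where "g r x = 6 * ((real r + 1)\<^sup>2 * (cmod (E r x))\<^sup>2 + W r x)" for r x
  define d where "d r = (real r + 1)\<^sup>2 * (\<Sum>k\<in>{2^r..<2^Suc r}. c k)" for r
  define G where "G x = (\<Sum>r. ennreal (g r x))" for x
  have d: "summable d"
    unfolding d_def by (rule summable_dyadic_blocks_of_log_weighted[OF c sm])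
  have d0: "d r \<ge> 0" for r
    using c by (auto simp: d_def intro!: mult_nonneg_nonneg sum_nonneg)
  have g0: "g r x \<ge> 0" for r x
    by (simp add: g_def W(2))
  have E_mem: "L2_mem M (E r)" for r
    using L2_mem_sum[of "{2^r..<2^Suc r}" M D "\<lambda>_. 1"] D by (simp add: E_def[abs_def])
  then have E_int: "integrable M (\<lambda>x. (cmod (E r x))\<^sup>2)" for r
    by (simp add: L2_mem_def)
  have g_int: "integrable M (g r)" for r
    unfolding g_def using E_int W(1) by simp
  then have g_meas [measurable]: "g r \<in> borel_measurable M" for r
    by auto
  have g_le: "(\<integral>x. g r x \<partial>M) \<le> 12 * d r" for r
  proof -
    have "(L2_norm M (E r))\<^sup>2 \<le> (\<Sum>k\<in>{2^r..<2^Suc r}. c k)"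
      unfolding E_def[abs_def] by (rule orth) simp
    then have "(real r + 1)\<^sup>2 * (L2_norm M (E r))\<^sup>2 \<le> d r"
      unfolding d_def by (rule mult_left_mono) simp
    moreover have "(\<integral>x. W r x \<partial>M) \<le> d r"
      using W(4)[of r] by (simp add: d_def mult_2)
    moreover have "(\<integral>x. g r x \<partial>M) = 6 * ((real r + 1)\<^sup>2 * (L2_norm M (E r))\<^sup>2 + (\<integral>x. W r x \<partial>M))"
      unfolding g_def L2_norm_power2 using E_int W(1) by simp
    ultimately show ?thesis by simp
  qed
  have "(\<integral>\<^sup>+x. G x \<partial>M) = (\<Sum>r. \<integral>\<^sup>+x. ennreal (g r x) \<partial>M)"
    unfolding G_def by (rule nn_integral_suminf) simp
  also have "\<dots> = (\<Sum>r. ennreal (\<integral>x. g r x \<partial>M))"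
    using g_int g0 by (simp add: nn_integral_eq_integral)
  also have "\<dots> \<le> (\<Sum>r. ennreal (12 * d r))"
    by (intro suminf_le ennreal_leI g_le) auto
  also have "\<dots> < \<infinity>"
    unfolding infinity_ennreal_def less_top[symmetric]
    by (rule ennreal_suminf_neq_top[OF summable_mult[OF d]]) (simp add: d0)
  finally have G_fin: "(\<integral>\<^sup>+x. G x \<partial>M) < \<infinity>" .
  have G_meas: "G \<in> borel_measurable M"
    unfolding G_def[abs_def] by measurable

  have conv: "convergent (\<lambda>n. \<Sum>k\<in>{1..<n}. D k x)"
    and bd: "ennreal ((cmod (\<Sum>k\<in>{1..<n}. D k x))\<^sup>2) \<le> G x" if fin: "G x < \<infinity>" for x n
  proof -
    define u where "u n = (\<Sum>k\<in>{1..<n}. D k x)" for n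
    have g: "summable (\<lambda>r. g r x)"
      using fin by (intro summable_suminf_not_top g0) (simp add: G_def)
    have Gx: "G x = ennreal (\<Sum>r. g r x)"
      unfolding G_def by (rule suminf_ennreal2[OF g0 g])
    have smW: "summable (\<lambda>r. W r x)"
      by (rule summable_comparison_test'[OF g, of 0]) (auto simp: g_def W(2))
    have smE2: "summable (\<lambda>r. (real r + 1)\<^sup>2 * (cmod (E r x))\<^sup>2)"
      by (rule summable_comparison_test'[OF g, of 0]) (auto simp: g_def W(2))
    have smE: "summable (\<lambda>r. cmod (E r x))"
      by (rule summable_of_weighted_squares(1)[OF norm_ge_zero smE2])
    have u_dyadic: "u (2^r) = (\<Sum>j<r. E j x)" for r
      unfolding u_def E_def by (rule sum_dyadic_intervals[symmetric])
    have u_block: "(cmod (u n - u (2^r)))\<^sup>2 \<le> W r x" if "2^r \<le> n" "n < 2^Suc r" for r n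
    proof -
      have "u n = u (2^r) + (\<Sum>k\<in>{2^r..<n}. D k x)"
        unfolding u_def using that by (subst sum.atLeastLessThan_concat) auto
      then show ?thesis
        using W(3)[of "n - 2^r" r x] that by simp
    qed
    have "convergent u"
    proof (rule convergent_of_dyadic_blocks)
      show "convergent (\<lambda>r. u (2^r))"
        unfolding u_dyadic using summable_norm_cancel[OF smE] by (simp add: summable_iff_convergent)
      show "(\<lambda>r. sqrt (W r x)) \<longlonglongrightarrow> 0"
        using tendsto_real_sqrt[OF summable_LIMSEQ_zero[OF smW]] by simp
      show "cmod (u n - u (2^r)) \<le> sqrt (W r x)" if "2^r \<le> n" "n < 2^Suc r" for r n
        using u_block[OF that] by (rule real_le_rsqrt)
    qed
    then show "convergent (\<lambda>n. \<Sum>k\<in>{1..<n}. D k x)"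
      by (simp add: u_def[abs_def])
    have "(cmod (u n))\<^sup>2 \<le> (\<Sum>r. g r x)"
    proof (cases "n \<ge> 1")
      case True
      then obtain r where r: "2^r \<le> n" "n < 2^Suc r" by (rule ex_dyadic_block)
      have "cmod (u (2^r)) \<le> (\<Sum>j<r. cmod (E j x))"
        unfolding u_dyadic by (rule norm_sum)
      also have "\<dots> \<le> (\<Sum>j. cmod (E j x))"
        by (intro sum_le_suminf smE) auto
      finally have "(cmod (u (2^r)))\<^sup>2 \<le> (\<Sum>j. cmod (E j x))\<^sup>2"
        by (rule power_mono) simp
      also have "\<dots> \<le> pi\<^sup>2 / 6 * (\<Sum>j. (real j + 1)\<^sup>2 * (cmod (E j x))\<^sup>2)"
        by (rule summable_of_weighted_squares(2)[OF norm_ge_zero smE2])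
      also have "\<dots> \<le> 3 * (\<Sum>j. (real j + 1)\<^sup>2 * (cmod (E j x))\<^sup>2)"
      proof (intro mult_right_mono suminf_nonneg smE2)
        have "pi\<^sup>2 \<le> 4\<^sup>2" using pi_less_4 by (intro power_mono) auto
        then show "pi\<^sup>2 / 6 \<le> 3" by simp
      qed auto
      finally have 1: "(cmod (u (2^r)))\<^sup>2 \<le> 3 * (\<Sum>j. (real j + 1)\<^sup>2 * (cmod (E j x))\<^sup>2)" .
      have "W r x \<le> (\<Sum>j. W j x)"
        using sum_le_suminf[OF smW, of "{r}"] W(2) by simp
      then have 2: "(cmod (u n - u (2^r)))\<^sup>2 \<le> (\<Sum>j. W j x)"
        using u_block[OF r] by simp
      have 3: "(\<Sum>j. W j x) \<ge> 0"
        by (intro suminf_nonneg smW W(2))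
      have "cmod (u n) \<le> cmod (u (2^r)) + cmod (u n - u (2^r))"
        using norm_triangle_ineq[of "u (2^r)" "u n - u (2^r)"] by simp
      then have "(cmod (u n))\<^sup>2 \<le> (cmod (u (2^r)) + cmod (u n - u (2^r)))\<^sup>2"
        by (rule power_mono) simp
      also have "\<dots> \<le> 2 * (cmod (u (2^r)))\<^sup>2 + 2 * (cmod (u n - u (2^r)))\<^sup>2"
        using sum_squares_bound[of "cmod (u (2^r))" "cmod (u n - u (2^r))"] by (simp add: power2_sum)
      also have "\<dots> \<le> 6 * ((\<Sum>j. (real j + 1)\<^sup>2 * (cmod (E j x))\<^sup>2) + (\<Sum>j. W j x))"
        using 1 2 3 by simp
      also have "\<dots> = (\<Sum>r. g r x)"
        unfolding g_def using smW smE2 by (simp only: suminf_add suminf_mult summable_add)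
      finally show ?thesis .
    qed (auto simp: u_def intro!: suminf_nonneg g g0)
    then show "ennreal ((cmod (\<Sum>k\<in>{1..<n}. D k x))\<^sup>2) \<le> G x"
      unfolding Gx by (intro ennreal_leI) (simp add: u_def)
  qed
  have "ennreal ((cmod (\<Sum>k\<in>{1..<n}. D k x))\<^sup>2) \<le> G x" for x n
    using bd[of x n] by (cases "G x < \<infinity>") (auto simp: less_top[symmetric])
  then show ?thesis
    using that[of G] G_meas G_fin conv by blast
qed

section \<open>Convergence almost everywhere and the maximal function\<close>

lemma SUP_ennreal_power2_le:
  assumes "\<And>i. i \<in> I \<Longrightarrow> y i \<ge> 0" "\<And>i. i \<in> I \<Longrightarrow> ennreal ((y i)\<^sup>2) \<le> H"
  shows "(SUP i\<in>I. ennreal (y i))\<^sup>2 \<le> H"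
proof (cases H)
  case (real h)
  have "(SUP i\<in>I. ennreal (y i)) \<le> ennreal (sqrt h)"
    using assms real by (intro SUP_least ennreal_leI real_le_rsqrt) auto
  then have "(SUP i\<in>I. ennreal (y i))\<^sup>2 \<le> (ennreal (sqrt h))\<^sup>2"
    by (rule power_mono) simp
  also have "\<dots> = H"
    using real by (simp add: ennreal_power)
  finally show ?thesis .
qed simp

theorem mainTheorem9:
  fixes a :: "nat \<Rightarrow> complex"
    and M :: "'y measure"
    and P :: "('y \<Rightarrow> complex) \<Rightarrow> ('y \<Rightarrow> complex)"
    and f :: "'y \<Rightarrow> complex"
  assumes "norlund_bounded (\<lambda>n. complex_of_real (cmod (a n)))"
    and "sigma_finite_measure M"
    and "L2_contraction M P"
    and "L2_mem M f"
    and "summable (\<lambda>n. if n \<ge> 1 then (ln (real n + 1))\<^sup>2 * (\<Sum>k\<le>2^(n+1). cmod (a k))\<^sup>2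
                                        * (L2_norm M ((P ^^ (2^n)) f))\<^sup>2 else 0)"
  shows "(AE x in M. summable (\<lambda>n. a n * (P ^^ n) f x)) \<and>
         (\<integral>\<^sup>+ x. (SUP N\<in>{1..}. ennreal (cmod (\<Sum>n\<le>N. a n * (P ^^ n) f x)))\<^sup>2 \<partial>M) < \<infinity>"
proof -
  note P = assms(3) and f = assms(4)
  note mem = L2_contraction_funpow_mem[OF P f]
  define c where "c k = (\<Sum>j\<le>2^(k+1). cmod (a j))\<^sup>2 * (L2_norm M ((P ^^ (2^k)) f))\<^sup>2" for k
  define S where "S N x = (\<Sum>n\<le>N. a n * (P ^^ n) f x)" for N x
  define D where "D k x = (\<Sum>n\<in>{2^k<..2^Suc k}. a n * (P ^^ n) f x)" for k x
  \<comment> \<open>By the triangle inequality \<open>Z k\<close> dominates every partial sum inside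
    block \<open>k\<close>, so the oscillation there needs no maximal inequality.\<close>
  define Z where "Z k x = (\<Sum>n\<in>{2^k<..2^Suc k}. cmod (a n) * cmod ((P ^^ n) f x))" for k x
  have c0: "c k \<ge> 0" for k by (simp add: c_def)
  have sm: "summable (\<lambda>k. if k \<ge> 1 then (ln (real k + 1))\<^sup>2 * c k else 0)"
    using assms(5) by (simp add: c_def mult.assoc cong: if_cong)
  have c_sm: "summable c"
  \<comment> \<open>The comparison starts at index 1, where the logarithm is at least ln 2; at index
    0 the weighted series has no term to compare with.\<close>
  proof (rule summable_comparison_test'[OF summable_mult[OF sm, of "1 / (ln 2)\<^sup>2"], of 1])
    fix k :: nat assume "k \<ge> 1"
    then have "(ln 2)\<^sup>2 \<le> (ln (real k + 1))\<^sup>2"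
      by (intro power_mono ln_mono) auto
    then have "(ln 2)\<^sup>2 * c k \<le> (ln (real k + 1))\<^sup>2 * c k"
      by (rule mult_right_mono[OF _ c0])
    then show "norm (c k) \<le> 1 / (ln 2)\<^sup>2 * (if k \<ge> 1 then (ln (real k + 1))\<^sup>2 * c k else 0)"
      using \<open>k \<ge> 1\<close> c0[of k] by (simp add: field_simps)
  qed

  obtain K where K: "K \<ge> 0"
    "\<And>s t. s < t \<Longrightarrow> (L2_norm M (\<lambda>x. \<Sum>n\<in>{2^s<..2^t}. a n * (P ^^ n) f x))\<^sup>2 \<le> K * (\<Sum>k\<in>{s..<t}. c k)"
    unfolding c_def using dyadic_block_estimate[OF P f assms(1)] by blast
  have D_sum: "(\<Sum>k\<in>{s..<t}. D k x) = (\<Sum>n\<in>{2^s<..2^t}. a n * (P ^^ n) f x)" if "s \<le> t" for s t x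
    unfolding D_def by (rule sum_dyadic_blocks[OF that])
  have D_mem: "L2_mem M (D k)" for k
    unfolding D_def[abs_def] by (rule L2_mem_sum) (auto simp: mem)
  have S_mem: "L2_mem M (S N)" for N
    unfolding S_def[abs_def] by (rule L2_mem_sum) (auto simp: mem)
  obtain G where G: "G \<in> borel_measurable M" "(\<integral>\<^sup>+x. G x \<partial>M) < \<infinity>"
    "\<And>x. G x < \<infinity> \<Longrightarrow> convergent (\<lambda>n. \<Sum>k\<in>{1..<n}. D k x)"
    "\<And>x n. ennreal ((cmod (\<Sum>k\<in>{1..<n}. D k x))\<^sup>2) \<le> G x"
  proof (rule rademacher_menshov[of M D "\<lambda>k. K * c k"])
    show "(L2_norm M (\<lambda>x. \<Sum>k\<in>{s..<t}. D k x))\<^sup>2 \<le> (\<Sum>k\<in>{s..<t}. K * c k)" if "s < t" for s t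
      using K(2)[OF that] that by (simp add: D_sum sum_distrib_left)
    show "summable (\<lambda>k. if k \<ge> 1 then (ln (real k + 1))\<^sup>2 * (K * c k) else 0)"
      using summable_mult[OF sm, of K] by (simp add: if_distrib mult_ac cong: if_cong)
  qed (use D_mem K(1) c0 in auto)

  have abs_mem: "L2_mem M (\<lambda>x. complex_of_real (cmod ((P ^^ n) f x)))" for n
    using mem[of n] by (auto simp: L2_mem_def)
  have Z0: "Z k x \<ge> 0" for k x
    by (auto simp: Z_def intro!: sum_nonneg)
  \<comment> \<open>\<open>Z\<close> is recast as a complex combination because
    \<open>L2_mem_sum\<close> and \<open>L2_norm_sum\<close> speak of complex functions.\<close>
  have Z_complex: "complex_of_real (Z k x)
      = (\<Sum>n\<in>{2^k<..2^Suc k}. complex_of_real (cmod (a n)) * complex_of_real (cmod ((P ^^ n) f x)))" for k x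
    by (simp add: Z_def)
  have Z_mem: "L2_mem M (\<lambda>x. complex_of_real (Z k x))" for k
    unfolding Z_complex by (rule L2_mem_sum) (auto simp: abs_mem)
  then have Z_int: "integrable M (\<lambda>x. (Z k x)\<^sup>2)" for k
    by (simp add: L2_mem_def)
  have Z_le: "(\<integral>x. (Z k x)\<^sup>2 \<partial>M) \<le> c k" for k
  proof -
    have "L2_norm M (\<lambda>x. complex_of_real (Z k x))
        \<le> (\<Sum>n\<in>{2^k<..2^Suc k}. cmod (complex_of_real (cmod (a n)))
              * L2_norm M (\<lambda>x. complex_of_real (cmod ((P ^^ n) f x))))"
      unfolding Z_complex by (rule L2_norm_sum) (auto simp: abs_mem)
    also have "\<dots> = (\<Sum>n\<in>{2^k<..2^Suc k}. cmod (a n) * L2_norm M ((P ^^ n) f))"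
      by (simp add: L2_norm_def)
    also have "\<dots> \<le> (\<Sum>n\<in>{2^k<..2^Suc k}. cmod (a n) * L2_norm M ((P ^^ (2^k)) f))"
      by (intro sum_mono mult_left_mono L2_contraction_funpow_antimono[OF P f]) auto
    also have "\<dots> = (\<Sum>n\<in>{2^k<..2^Suc k}. cmod (a n)) * L2_norm M ((P ^^ (2^k)) f)"
      by (simp add: sum_distrib_right)
    also have "\<dots> \<le> (\<Sum>j\<le>2^(k+1). cmod (a j)) * L2_norm M ((P ^^ (2^k)) f)"
      by (intro mult_right_mono sum_mono2 L2_norm_nonneg) auto
    finally have "(L2_norm M (\<lambda>x. complex_of_real (Z k x)))\<^sup>2 \<le> c k"
      unfolding c_def power_mult_distrib[symmetric] by (rule power_mono[OF _ L2_norm_nonneg])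
    then show ?thesis
      by (simp add: L2_norm_power2)
  qed
  define Q where "Q x = (\<Sum>k. ennreal ((Z k x)\<^sup>2))" for x
  have Z_meas [measurable]: "(\<lambda>x. (Z k x)\<^sup>2) \<in> borel_measurable M" for k
    using Z_int by auto
  have Q_meas: "Q \<in> borel_measurable M"
    unfolding Q_def[abs_def] by measurable
  have "(\<integral>\<^sup>+x. Q x \<partial>M) = (\<Sum>k. \<integral>\<^sup>+x. ennreal ((Z k x)\<^sup>2) \<partial>M)"
    unfolding Q_def by (rule nn_integral_suminf) simp
  also have "\<dots> = (\<Sum>k. ennreal (\<integral>x. (Z k x)\<^sup>2 \<partial>M))"
    using Z_int by (simp add: nn_integral_eq_integral)
  also have "\<dots> \<le> (\<Sum>k. ennreal (c k))"
    by (intro suminf_le ennreal_leI Z_le) auto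
  also have "\<dots> < \<infinity>"
    using ennreal_suminf_neq_top[OF c_sm c0] by (simp add: less_top[symmetric])
  finally have Q_fin: "(\<integral>\<^sup>+x. Q x \<partial>M) < \<infinity>" .

  \<comment> \<open>The block sums run from index 1, hence begin after n = 2; the terms with n \<le>
    2 are collected in \<open>S 2\<close>.\<close>
  have S_dyadic: "S (2^k) x = S 2 x + (\<Sum>j\<in>{1..<k}. D j x)" if "k \<ge> 1" for k x
  proof -
    have "(2::nat) \<le> 2^k" using power_increasing[OF that, of "2::nat"] by simp
    then have "{..2^k} = {..2} \<union> {2<..(2::nat)^k}" by auto
    then have "S (2^k) x = S 2 x + (\<Sum>n\<in>{2<..2^k}. a n * (P ^^ n) f x)"
      unfolding S_def by (subst sum.union_disjoint[symmetric]) auto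
    then show ?thesis using D_sum[OF that] by simp
  qed
  have S_block: "cmod (S N x - S (2^k) x) \<le> Z k x" if "2^k \<le> N" "N < 2^Suc k" for k N x
  proof -
    have "{..N} = {..2^k} \<union> {2^k<..N}" using that by auto
    then have "S N x = S (2^k) x + (\<Sum>n\<in>{2^k<..N}. a n * (P ^^ n) f x)"
      unfolding S_def by (subst sum.union_disjoint[symmetric]) auto
    then have "S N x - S (2^k) x = (\<Sum>n\<in>{2^k<..N}. a n * (P ^^ n) f x)"
      by simp
    also have "cmod \<dots> \<le> (\<Sum>n\<in>{2^k<..N}. cmod (a n) * cmod ((P ^^ n) f x))"
      by (rule norm_sum[THEN order_trans]) (simp add: norm_mult)
    also have "\<dots> \<le> Z k x"
      unfolding Z_def using that by (intro sum_mono2) auto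
    finally show ?thesis .
  qed

  have "AE x in M. G x \<noteq> \<infinity>"
    by (rule nn_integral_PInf_AE[OF G(1)]) (use G(2) in auto)
  moreover have "AE x in M. Q x \<noteq> \<infinity>"
    by (rule nn_integral_PInf_AE[OF Q_meas]) (use Q_fin in auto)
  ultimately have AE: "AE x in M. summable (\<lambda>n. a n * (P ^^ n) f x)"
  proof eventually_elim
    case (elim x)
    have "convergent (\<lambda>N. S N x)"
    proof (rule convergent_of_dyadic_blocks)
      have "convergent (\<lambda>k. S 2 x + (\<Sum>j\<in>{1..<k}. D j x))"
        using G(3)[of x] elim by (simp add: less_top convergent_add_const_iff)
      then obtain l where "(\<lambda>k. S 2 x + (\<Sum>j\<in>{1..<k}. D j x)) \<longlonglongrightarrow> l"
        by (auto simp: convergent_def)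
      then have "(\<lambda>k. S (2^k) x) \<longlonglongrightarrow> l"
        by (rule Lim_transform_eventually)
           (auto simp: S_dyadic intro!: eventually_sequentiallyI[of 1])
      then show "convergent (\<lambda>k. S (2^k) x)"
        by (auto simp: convergent_def)
      \<comment> \<open>Finiteness of \<open>Q x\<close> forces \<open>Z k x\<close> to tend to 0,
        which is the oscillation condition.\<close>
      have "summable (\<lambda>k. (Z k x)\<^sup>2)"
        using elim by (intro summable_suminf_not_top) (auto simp: Q_def)
      then have "(\<lambda>k. sqrt ((Z k x)\<^sup>2)) \<longlonglongrightarrow> sqrt 0"
        by (intro tendsto_real_sqrt summable_LIMSEQ_zero)
      then show "(\<lambda>k. Z k x) \<longlonglongrightarrow> 0"
        using Z0 by simp
    qed (rule S_block)
    then show ?case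
      by (simp add: S_def summable_iff_convergent')
  qed

  \<comment> \<open>\<open>S 1\<close> covers block 0, \<open>S 2\<close> is the base point for the
    later blocks, \<open>G\<close> bounds the sums of whole blocks and \<open>Q\<close> the
    remainder inside a block. The factor 4 comes from squaring a sum of four terms.\<close>
  define H where "H x = 4 * (ennreal ((cmod (S 1 x))\<^sup>2) + ennreal ((cmod (S 2 x))\<^sup>2) + G x + Q x)" for x
  have S_le_H: "ennreal ((cmod (S N x))\<^sup>2) \<le> H x" if N: "N \<ge> 1" for N x
  proof -
    obtain k where k: "2^k \<le> N" "N < 2^Suc k" using N by (rule ex_dyadic_block)
    define v where "v = cmod (\<Sum>j\<in>{1..<k}. D j x)"
    have "cmod (S (2^k) x) \<le> cmod (S 1 x) + cmod (S 2 x) + v"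
    proof (cases "k \<ge> 1")
      case True
      show ?thesis
        unfolding S_dyadic[OF True] v_def
        using norm_triangle_ineq[of "S 2 x" "\<Sum>j\<in>{1..<k}. D j x"] norm_ge_zero[of "S 1 x"] by linarith
    next
      case False
      then have "k = 0" by simp
      then show ?thesis by (simp add: v_def)
    qed
    then have "cmod (S N x) \<le> cmod (S 1 x) + cmod (S 2 x) + v + Z k x"
      using norm_triangle_ineq[of "S (2^k) x" "S N x - S (2^k) x"] S_block[OF k, of x] by simp
    then have "(cmod (S N x))\<^sup>2 \<le> (cmod (S 1 x) + cmod (S 2 x) + v + Z k x)\<^sup>2"
      by (rule power_mono) simp
    also have "\<dots> \<le> 4 * ((cmod (S 1 x))\<^sup>2 + (cmod (S 2 x))\<^sup>2 + v\<^sup>2 + (Z k x)\<^sup>2)"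
    proof -
      \<comment> \<open>The difference of the two sides is the sum of the squares of the six
        pairwise differences.\<close>
      have "4 * (p\<^sup>2 + q\<^sup>2 + r\<^sup>2 + s\<^sup>2) - (p + q + r + s)\<^sup>2
          = (p - q)\<^sup>2 + (p - r)\<^sup>2 + (p - s)\<^sup>2 + (q - r)\<^sup>2 + (q - s)\<^sup>2 + (r - s)\<^sup>2" for p q r s :: real
        by (simp add: power2_eq_square algebra_simps)
      moreover have "\<dots> p q r s \<ge> 0" for p q r s
        by simp
      ultimately show ?thesis by (metis diff_ge_0_iff_ge)
    qed
    finally have "ennreal ((cmod (S N x))\<^sup>2)
        \<le> ennreal (4 * ((cmod (S 1 x))\<^sup>2 + (cmod (S 2 x))\<^sup>2 + v\<^sup>2 + (Z k x)\<^sup>2))"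
      by (rule ennreal_leI)
    also have "\<dots> = 4 * (ennreal ((cmod (S 1 x))\<^sup>2) + ennreal ((cmod (S 2 x))\<^sup>2)
        + ennreal (v\<^sup>2) + ennreal ((Z k x)\<^sup>2))"
      by (simp add: ennreal_mult ennreal_plus)
    also have "\<dots> \<le> H x"
      unfolding H_def
    proof (intro mult_left_mono add_mono order_refl)
      show "ennreal (v\<^sup>2) \<le> G x"
        unfolding v_def by (rule G(4))
      show "ennreal ((Z k x)\<^sup>2) \<le> Q x"
      proof -
        have "(\<Sum>j\<in>{k}. ennreal ((Z j x)\<^sup>2)) \<le> Q x"
          unfolding Q_def by (rule sum_le_suminf[OF summableI]) simp_all
        then show ?thesis by simp
      qed
    qed simp
    finally show ?thesis .
  qed
  have S_fin: "(\<integral>\<^sup>+x. ennreal ((cmod (S N x))\<^sup>2) \<partial>M) < \<infinity>" for N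
  proof -
    have "(\<integral>\<^sup>+x. ennreal ((cmod (S N x))\<^sup>2) \<partial>M) = ennreal (\<integral>x. (cmod (S N x))\<^sup>2 \<partial>M)"
      using S_mem[of N] by (intro nn_integral_eq_integral) (auto simp: L2_mem_def)
    then show ?thesis by simp
  qed
  have [measurable]: "S N \<in> borel_measurable M" for N
    using S_mem[of N] by (simp add: L2_mem_def)
  note [measurable] = G(1) Q_meas
  have "(\<integral>\<^sup>+x. (SUP N\<in>{1..}. ennreal (cmod (S N x)))\<^sup>2 \<partial>M) \<le> (\<integral>\<^sup>+x. H x \<partial>M)"
    using S_le_H by (intro nn_integral_mono SUP_ennreal_power2_le) auto
  also have "\<dots> = 4 * ((\<integral>\<^sup>+x. ennreal ((cmod (S 1 x))\<^sup>2) \<partial>M) + (\<integral>\<^sup>+x. ennreal ((cmod (S 2 x))\<^sup>2) \<partial>M)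
      + (\<integral>\<^sup>+x. G x \<partial>M) + (\<integral>\<^sup>+x. Q x \<partial>M))"
    unfolding H_def by (simp add: nn_integral_cmult nn_integral_add)
  also have "\<dots> < \<infinity>"
    using S_fin G(2) Q_fin by (simp add: ennreal_mult_less_top)
  finally show ?thesis
    using AE by (simp add: S_def)
qed

end
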